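(* There exists a continuum that is finite-dimensional closed set-aposyndetic but is not weakly infinite-dimensional closed set-aposyndetic.
   Context: All spaces are metrizable. A compactum is a compact metric space; a continuum is a connected compactum. A compactum $Y$ is weakly infinite-dimensional if for each countable family $\{(A_i,B_i)\}_{i=1}^\infty$ of pairs of disjoint closed subsets of $Y$ there exists a family $\{L_i\}_{i=1}^\infty$ of closed subsets of $Y$ such that $L_i$ is a partition in $Y$ between $A_i$ and $B_i$ for each $i\in\mathbb{N}$, and $\bigcap_{i=1}^\infty L_i=\emptyset$. A continuum $X$ is finite-dimensional closed set-aposyndetic (resp. weakly infinite-dimensional closed set-aposyndetic) if for each $x\in X$ and each finite-dimensional closed subset (resp. weakly infinite-dimensional closed subset) $A$ of $X$ with $A\subseteq X\setminus\{x\}$ there exists a subcontinuum $T$ of $X$ such that $x\in\mathrm{Int}_X T\subseteq T\subseteq X\setminus A$. *)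

theory Defs
  imports "HOL-Analysis.Analysis"
begin

definition compactum :: "'a topology \<Rightarrow> bool" where
  "compactum X \<longleftrightarrow> compact_space X \<and> metrizable_space X"

definition continuum :: "'a topology \<Rightarrow> bool" where
  "continuum X \<longleftrightarrow> compactum X \<and> connected_space X \<and> topspace X \<noteq> {}"

definition subcontinuum_of :: "'a set \<Rightarrow> 'a topology \<Rightarrow> bool" where
  "subcontinuum_of T X \<longleftrightarrow> T \<subseteq> topspace X \<and> continuum (subtopology X T)"

definition open_cover_of :: "'a set set \<Rightarrow> 'a topology \<Rightarrow> bool" where
  "open_cover_of \<U> X \<longleftrightarrow> (\<forall>U\<in>\<U>. openin X U) \<and> \<Union>\<U> = topspace X"

text \<open>Lebesgue covering dimension: every finite open cover has a finite open refinement
  in which no \<open>n + 2\<close> distinct members have a common point. On compact metrizable spaces it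
  coincides with the small and the large inductive dimension. The empty space, of
  dimension \<open>-1\<close>, satisfies this for every \<open>n\<close>.\<close>

definition covering_dim_le :: "'a topology \<Rightarrow> nat \<Rightarrow> bool" where
  "covering_dim_le X n \<longleftrightarrow>
     (\<forall>\<U>. finite \<U> \<and> open_cover_of \<U> X \<longrightarrow>
        (\<exists>\<V>. finite \<V> \<and> open_cover_of \<V> X \<and> (\<forall>V\<in>\<V>. \<exists>U\<in>\<U>. V \<subseteq> U) \<and>
             (\<forall>\<F>. \<F> \<subseteq> \<V> \<and> card \<F> = n + 2 \<longrightarrow> \<Inter>\<F> = {})))"

definition finite_dimensional :: "'a topology \<Rightarrow> bool" where
  "finite_dimensional X \<longleftrightarrow> (\<exists>n. covering_dim_le X n)"

definition partition_between :: "'a topology \<Rightarrow> 'a set \<Rightarrow> 'a set \<Rightarrow> 'a set \<Rightarrow> bool" where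
  "partition_between Y L A B \<longleftrightarrow>
     closedin Y L \<and>
     (\<exists>U V. openin Y U \<and> openin Y V \<and> A \<subseteq> U \<and> B \<subseteq> V \<and> U \<inter> V = {} \<and>
            topspace Y - L = U \<union> V)"

definition weakly_infinite_dimensional :: "'a topology \<Rightarrow> bool" where
  "weakly_infinite_dimensional Y \<longleftrightarrow>
     (\<forall>A B :: nat \<Rightarrow> 'a set.
        (\<forall>i. closedin Y (A i) \<and> closedin Y (B i) \<and> A i \<inter> B i = {}) \<longrightarrow>
        (\<exists>L :: nat \<Rightarrow> 'a set. (\<forall>i. partition_between Y (L i) (A i) (B i)) \<and> (\<Inter>i. L i) = {}))"

definition finite_dimensional_closed_set_aposyndetic :: "'a topology \<Rightarrow> bool" where
  "finite_dimensional_closed_set_aposyndetic X \<longleftrightarrow>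
     (\<forall>x A. x \<in> topspace X \<and> closedin X A \<and> finite_dimensional (subtopology X A) \<and>
            A \<subseteq> topspace X - {x} \<longrightarrow>
        (\<exists>T. subcontinuum_of T X \<and> x \<in> X interior_of T \<and> T \<subseteq> topspace X - A))"

definition weakly_infinite_dimensional_closed_set_aposyndetic :: "'a topology \<Rightarrow> bool" where
  "weakly_infinite_dimensional_closed_set_aposyndetic X \<longleftrightarrow>
     (\<forall>x A. x \<in> topspace X \<and> closedin X A \<and> weakly_infinite_dimensional (subtopology X A) \<and>
            A \<subseteq> topspace X - {x} \<longrightarrow>
        (\<exists>T. subcontinuum_of T X \<and> x \<in> X interior_of T \<and> T \<subseteq> topspace X - A))"

end

theory Submission
  imports Defs
begin

text \<open>Inside the Hilbert cube \<open>Q\<close> take the compact set \<open>A\<close> formed by cubes of all finite dimensions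
  shrinking to the origin. The product of \<open>Q\<close> with a convergent sequence
  \<open>{0} \<union> {1/(n+1) | n}\<close> becomes a continuum \<open>X\<close> once all copies of \<open>Q\<close> are glued along \<open>A\<close>.
  The set \<open>A\<close> is weakly infinite-dimensional, and a continuum missing \<open>A\<close> stays in one copy
  of \<open>Q\<close>, so it is not a neighbourhood of a point of the limit copy. A finite-dimensional
  closed set \<open>F\<close>, on the other hand, neither separates \<open>Q\<close> nor contains \<open>A\<close>: within a copy,
  a point off \<open>F\<close> can be joined to a point of \<open>A\<close> off \<open>F\<close>, and by compactness the
  same continuum works in all nearby copies.\<close>

section \<open>The Hilbert cube and its opposite faces\<close>

text \<open>The gluing set is squeezed from two sides. It must be weakly infinite-dimensional, so
  that it is an admissible set to avoid, and it must lie in no finite-dimensional closed set, so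
  that each such set leaves a passage between the copies. Cubes of unbounded dimension give the
  latter. Finite support of every point gives the former: one can choose partitions whose points
  have a coordinate in prescribed dense sets, pairwise disjoint and omitting 0, and a common point
  would need infinitely many nonzero coordinates.

  Both facts about a finite-dimensional \<open>F\<close> come from one conflict. Closed sets that
  split a cube between opposite faces, one pair per coordinate, have a common point (a Brouwer-type
  statement, from Kuhn's lemma), whereas \<open>d + 1\<close> disjoint pairs can be split so that
  nothing in common remains on a set of covering dimension \<open>d\<close>. To show that
  \<open>F\<close> does not separate, one extra coordinate runs from one side of a supposed
  separation to the other.\<close>

lemma fun_interval_eq_PiE:
  fixes a b :: "'i \<Rightarrow> 'a::order"
  shows "{a..b} = PiE UNIV (\<lambda>i. {a i..b i})"
  by (auto simp: le_fun_def PiE_iff)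

lemma compact_fun_interval:
  fixes a b :: "'i \<Rightarrow> real"
  shows "compact {a..b}"
  using compactin_PiE[of "\<lambda>_. euclidean" UNIV "\<lambda>i. {a i..b i}"]
  by (simp add: euclidean_product_topology fun_interval_eq_PiE)

lemma connected_fun_interval:
  fixes a b :: "'i \<Rightarrow> real"
  shows "connected {a..b}"
  using connectedin_PiE[of "\<lambda>_. euclidean" UNIV "\<lambda>i. {a i..b i}"]
  by (simp add: euclidean_product_topology fun_interval_eq_PiE)

lemma open_coordinate_box:
  fixes z :: "nat \<Rightarrow> real"
  shows "open {x. \<forall>i<N. \<bar>x i - z i\<bar> < e}"
proof -
  have "open {x. \<forall>i\<in>{..<N}. x i \<in> {z i - e<..<z i + e}}"
    using product_topology_basis'[of "{..<N}" "\<lambda>i. {z i - e<..<z i + e}" "\<lambda>i. i"] by simp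
  moreover have "t \<in> {z i - e<..<z i + e} \<longleftrightarrow> \<bar>t - z i\<bar> < e" for t i
    by auto
  ultimately show ?thesis by (simp only: lessThan_iff Ball_def)
qed

lemma open_contains_coordinate_box:
  fixes z :: "nat \<Rightarrow> real"
  assumes "open U" "z \<in> U"
  obtains N e where "e > 0" "\<And>x. (\<And>i. i < N \<Longrightarrow> \<bar>x i - z i\<bar> \<le> e) \<Longrightarrow> x \<in> U"
proof -
  obtain X where X: "z \<in> PiE UNIV X" "\<And>i. open (X i)" "finite {i. X i \<noteq> UNIV}" "PiE UNIV X \<subseteq> U"
    using product_topology_open_contains_basis[of "\<lambda>_. euclidean" UNIV U z] assms
    by (auto simp: euclidean_product_topology)
  define J where "J = {i. X i \<noteq> UNIV}"
  have "\<exists>d>0. \<forall>t. \<bar>t - z i\<bar> \<le> d \<longrightarrow> t \<in> X i" for i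
  proof -
    have "z i \<in> X i" using X(1) by auto
    then obtain d where "d > 0" "cball (z i) d \<subseteq> X i"
      using X(2) open_contains_cball by blast
    then show ?thesis
      by (intro exI[of _ d]) (auto simp: dist_real_def subset_iff abs_minus_commute)
  qed
  then obtain d where d: "\<And>i. d i > 0" "\<And>i t. \<bar>t - z i\<bar> \<le> d i \<Longrightarrow> t \<in> X i"
    by metis
  \<comment> \<open>The element 1 keeps the minimum defined when no coordinate is
    constrained.\<close>
  define e where "e = Min (insert 1 (d ` J))"
  have fin: "finite J" using X(3) J_def by simp
  have "e > 0" using fin d(1) by (simp add: e_def)
  obtain N where N: "\<And>i. i \<in> J \<Longrightarrow> i < N"
    using fin unfolding finite_nat_set_iff_bounded by auto
  show thesis
  proof (rule that[OF \<open>e > 0\<close>, of N])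
    fix x :: "nat \<Rightarrow> real" assume x: "\<And>i. i < N \<Longrightarrow> \<bar>x i - z i\<bar> \<le> e"
    have "x i \<in> X i" for i
    proof (cases "i \<in> J")
      case True
      then have "e \<le> d i" using fin by (auto simp: e_def)
      then show ?thesis using order_trans[OF x[OF N[OF True]]] d(2) by blast
    qed (simp add: J_def)
    then show "x \<in> U" using X(4) by auto
  qed
qed

lemma LIMSEQ_coordinatewise:
  fixes f :: "nat \<Rightarrow> nat \<Rightarrow> real"
  assumes "\<And>i. (\<lambda>n. f n i) \<longlonglongrightarrow> l i"
  shows "f \<longlonglongrightarrow> l"
proof (rule topological_tendstoI)
  fix S assume "open S" "l \<in> S"
  then obtain N e where e: "e > 0" "\<And>x. (\<And>i. i < N \<Longrightarrow> \<bar>x i - l i\<bar> \<le> e) \<Longrightarrow> x \<in> S"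
    using open_contains_coordinate_box by metis
  have "\<forall>i\<in>{..<N}. \<forall>\<^sub>F n in sequentially. \<bar>f n i - l i\<bar> < e"
    using assms e(1) by (auto simp: tendsto_iff dist_real_def)
  then have "\<forall>\<^sub>F n in sequentially. \<forall>i\<in>{..<N}. \<bar>f n i - l i\<bar> < e"
    by (subst eventually_ball_finite_distrib) auto
  then show "\<forall>\<^sub>F n in sequentially. f n \<in> S"
    by eventually_elim (auto intro!: e(2) less_imp_le)
qed

lemma LIMSEQ_coordinate:
  fixes f :: "nat \<Rightarrow> nat \<Rightarrow> real"
  assumes "f \<longlonglongrightarrow> l"
  shows "(\<lambda>n. f n i) \<longlonglongrightarrow> l i"
  using continuous_on_tendsto_compose[OF continuous_on_product_coordinates[of i] assms] by simp

definition hilbert_cube :: "(nat \<Rightarrow> real) set" where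
  "hilbert_cube = {(\<lambda>_. 0)..(\<lambda>_. 1)}"

lemma hilbert_cube_iff: "x \<in> hilbert_cube \<longleftrightarrow> (\<forall>i. 0 \<le> x i \<and> x i \<le> 1)"
  by (auto simp: hilbert_cube_def le_fun_def)

lemma compact_hilbert_cube: "compact hilbert_cube"
  by (simp add: hilbert_cube_def compact_fun_interval)

lemma closed_hilbert_cube: "closed hilbert_cube"
  by (simp add: compact_hilbert_cube compact_imp_closed)

text \<open>A form of the Poincare-Miranda theorem. On the grid of mesh 1/(m+1) in the first
  \<open>n\<close> coordinates, Kuhn's lemma finds a cell that has, for each \<open>i\<close>, a
  vertex in \<open>P i\<close> and a vertex in \<open>R i\<close>. A subsequence of these cells
  shrinks to one point, which lies in all these closed sets.\<close>

lemma hilbert_cube_opposite_faces: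
  fixes P R :: "nat \<Rightarrow> (nat \<Rightarrow> real) set"
  assumes closed: "\<And>i. i < n \<Longrightarrow> closed (P i)" "\<And>i. i < n \<Longrightarrow> closed (R i)"
    and cover: "\<And>i x. i < n \<Longrightarrow> x \<in> hilbert_cube \<Longrightarrow> x \<in> P i \<or> x \<in> R i"
    and face0: "\<And>i x. i < n \<Longrightarrow> x \<in> hilbert_cube \<Longrightarrow> x i = 0 \<Longrightarrow> x \<in> P i"
    and face1: "\<And>i x. i < n \<Longrightarrow> x \<in> hilbert_cube \<Longrightarrow> x i = 1 \<Longrightarrow> x \<in> R i"
  shows "\<exists>x\<in>hilbert_cube. \<forall>i<n. x \<in> P i \<and> x \<in> R i"
proof -
  define pt :: "nat \<Rightarrow> (nat \<Rightarrow> nat) \<Rightarrow> nat \<Rightarrow> real"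
    where "pt p v = (\<lambda>j. if j < n then real (v j) / real p else 0)" for p v
  have pt_cube: "pt p v \<in> hilbert_cube" if "\<forall>i<n. v i \<le> p" for p v
    using that by (auto simp: pt_def hilbert_cube_iff divide_le_eq)
  have ex: "\<exists>q::nat \<Rightarrow> nat. (\<forall>i<n. q i < Suc m) \<and>
      (\<forall>i<n. \<exists>r s. (\<forall>j<n. q j \<le> r j \<and> r j \<le> q j + 1) \<and> (\<forall>j<n. q j \<le> s j \<and> s j \<le> q j + 1) \<and>
        pt (Suc m) r \<in> P i \<and> pt (Suc m) s \<in> R i)" for m
  proof -
    define p where "p = Suc m"
    \<comment> \<open>A point with \<open>v i = p\<close> may lie in \<open>P i\<close> as well; the
      clause \<open>v i \<noteq> p\<close> forces the label 1 that Kuhn's lemma demands there, and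
      \<open>face1\<close> still puts the point in \<open>R i\<close>.\<close>
    define label :: "(nat \<Rightarrow> nat) \<Rightarrow> nat \<Rightarrow> nat"
      where "label v i = (if pt p v \<in> P i \<and> v i \<noteq> p then 0 else 1)" for v i
    have in_P: "pt p v \<in> P i" if "label v i = 0" for v i
      using that by (auto simp: label_def split: if_splits)
    have in_R: "pt p v \<in> R i" if "label v i \<noteq> 0" "i < n" "\<forall>i<n. v i \<le> p" for v i
    proof (cases "v i = p")
      case True
      then show ?thesis using that face1[of i "pt p v"] pt_cube by (simp add: pt_def p_def)
    next
      case False
      then show ?thesis using that cover[of i "pt p v"] pt_cube
        by (auto simp: label_def split: if_splits)
    qed
    obtain q where q: "\<forall>i<n. q i < p"
      "\<forall>i<n. \<exists>r s. (\<forall>j<n. q j \<le> r j \<and> r j \<le> q j + 1) \<and> (\<forall>j<n. q j \<le> s j \<and> s j \<le> q j + 1) \<and> label r i \<noteq> label s i"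
    proof (rule kuhn_lemma[of p n label])
      show "0 < p" by (simp add: p_def)
      show "\<forall>x. (\<forall>i<n. x i \<le> p) \<longrightarrow> (\<forall>i<n. label x i = 0 \<or> label x i = 1)"
        by (simp add: label_def)
      show "\<forall>x. (\<forall>i<n. x i \<le> p) \<longrightarrow> (\<forall>i<n. x i = 0 \<longrightarrow> label x i = 0)"
        using face0 pt_cube by (auto simp: label_def pt_def p_def)
      show "\<forall>x. (\<forall>i<n. x i \<le> p) \<longrightarrow> (\<forall>i<n. x i = p \<longrightarrow> label x i = 1)"
        by (simp add: label_def)
    qed
    have "\<exists>r s. (\<forall>j<n. q j \<le> r j \<and> r j \<le> q j + 1) \<and> (\<forall>j<n. q j \<le> s j \<and> s j \<le> q j + 1) \<and>
        pt p r \<in> P i \<and> pt p s \<in> R i" if i: "i < n" for i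
    proof -
      obtain r s where rs: "\<forall>j<n. q j \<le> r j \<and> r j \<le> q j + 1" "\<forall>j<n. q j \<le> s j \<and> s j \<le> q j + 1"
        "label r i \<noteq> label s i"
        using q(2) i by blast
      have le: "\<forall>j<n. r j \<le> p" "\<forall>j<n. s j \<le> p"
        using rs(1,2) q(1) by fastforce+
      show ?thesis
      proof (cases "label r i = 0")
        case True
        then have "label s i \<noteq> 0" using rs(3) by simp
        then show ?thesis using rs in_P[OF True] in_R[OF _ i le(2)] by blast
      next
        case False
        then have "label s i = 0" using rs(3) by (auto simp: label_def split: if_splits)
        then show ?thesis using rs in_P in_R[OF False i le(1)] by blast
      qed
    qed
    then show ?thesis using q(1) unfolding p_def by blast
  qed
  then obtain q :: "nat \<Rightarrow> nat \<Rightarrow> nat" where q: "\<And>m. \<forall>i<n. q m i < Suc m"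
    and q2: "\<forall>m. \<forall>i<n. \<exists>r s. (\<forall>j<n. q m j \<le> r j \<and> r j \<le> q m j + 1) \<and> (\<forall>j<n. q m j \<le> s j \<and> s j \<le> q m j + 1) \<and>
        pt (Suc m) r \<in> P i \<and> pt (Suc m) s \<in> R i"
    by metis
  have pts: "\<forall>m. pt (Suc m) (q m) \<in> hilbert_cube"
    using q by (auto intro!: pt_cube less_imp_le)
  obtain x f where x: "x \<in> hilbert_cube" "strict_mono f" "(\<lambda>k. pt (Suc (f k)) (q (f k))) \<longlonglongrightarrow> x"
    by (rule seq_compactE[OF compact_imp_seq_compact[OF compact_hilbert_cube] pts])
      (simp add: comp_def)
  \<comment> \<open>Any choice of vertices has the same limit as the lower corners \<open>q\<close>,
    so the vertices found for different \<open>i\<close> all lead to the same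
    \<open>x\<close>.\<close>
  have close: "(\<lambda>k. pt (Suc (f k)) (r k)) \<longlonglongrightarrow> x"
    if r: "\<And>k j. j < n \<Longrightarrow> q (f k) j \<le> r k j \<and> r k j \<le> q (f k) j + 1" for r
  proof (rule LIMSEQ_coordinatewise)
    fix j
    have lim: "(\<lambda>k. pt (Suc (f k)) (q (f k)) j) \<longlonglongrightarrow> x j"
      using LIMSEQ_coordinate[OF x(3)] .
    have "(\<lambda>k. pt (Suc (f k)) (r k) j - pt (Suc (f k)) (q (f k)) j) \<longlonglongrightarrow> 0"
    proof (rule tendsto_0_le[where K = 1])
      show "(\<lambda>k. inverse (real (Suc (f k)))) \<longlonglongrightarrow> 0"
        using LIMSEQ_subseq_LIMSEQ[OF LIMSEQ_inverse_real_of_nat x(2)] by (simp add: comp_def)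
      have "\<bar>pt (Suc (f k)) (r k) j - pt (Suc (f k)) (q (f k)) j\<bar> \<le> inverse (real (Suc (f k)))" for k
        using r[of j k] by (auto simp: pt_def inverse_eq_divide diff_divide_distrib[symmetric] abs_if divide_right_mono)
      then show "\<forall>\<^sub>F k in sequentially. norm (pt (Suc (f k)) (r k) j - pt (Suc (f k)) (q (f k)) j)
          \<le> norm (inverse (real (Suc (f k)))) * 1"
        by (intro always_eventually allI) (simp add: abs_of_nonneg)
    qed
    from tendsto_add[OF lim this] show "(\<lambda>k. pt (Suc (f k)) (r k) j) \<longlonglongrightarrow> x j"
      by simp
  qed
  have "x \<in> P i \<and> x \<in> R i" if i: "i < n" for i
  proof -
    have "\<forall>k. \<exists>r s. (\<forall>j<n. q (f k) j \<le> r j \<and> r j \<le> q (f k) j + 1) \<and>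
        (\<forall>j<n. q (f k) j \<le> s j \<and> s j \<le> q (f k) j + 1) \<and>
        pt (Suc (f k)) r \<in> P i \<and> pt (Suc (f k)) s \<in> R i"
      using q2 i by simp
    from choice[OF this] obtain r where "\<forall>k. \<exists>s. (\<forall>j<n. q (f k) j \<le> r k j \<and> r k j \<le> q (f k) j + 1) \<and>
        (\<forall>j<n. q (f k) j \<le> s j \<and> s j \<le> q (f k) j + 1) \<and>
        pt (Suc (f k)) (r k) \<in> P i \<and> pt (Suc (f k)) s \<in> R i" ..
    from choice[OF this] obtain s where rs: "\<forall>k. (\<forall>j<n. q (f k) j \<le> r k j \<and> r k j \<le> q (f k) j + 1) \<and>
        (\<forall>j<n. q (f k) j \<le> s k j \<and> s k j \<le> q (f k) j + 1) \<and>
        pt (Suc (f k)) (r k) \<in> P i \<and> pt (Suc (f k)) (s k) \<in> R i" ..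
    have "x \<in> P i"
      by (rule closed_sequentially[OF closed(1)[OF i] _ close[of r]]) (use rs in auto)
    moreover have "x \<in> R i"
      by (rule closed_sequentially[OF closed(2)[OF i] _ close[of s]]) (use rs in auto)
    ultimately show ?thesis ..
  qed
  with x(1) show ?thesis by blast
qed

section \<open>Consequences of finite covering dimension\<close>

lemma covering_dim_leE:
  assumes "covering_dim_le X n" "open_cover_of \<U> X" "finite \<U>"
  obtains \<V> where "finite \<V>" "open_cover_of \<V> X" "\<forall>V\<in>\<V>. \<exists>U\<in>\<U>. V \<subseteq> U"
    "\<forall>\<F>. \<F> \<subseteq> \<V> \<and> card \<F> = n + 2 \<longrightarrow> \<Inter>\<F> = {}"
  using assms(1)[unfolded covering_dim_le_def, rule_format, OF conjI, OF assms(3,2)]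
  by (elim exE conjE)

text \<open>Monotonicity of dimension up to an embedding; it passes the dimension of
  \<open>F\<close> to the trace of \<open>F\<close> on one copy of the cube. Closed subsets of
  \<open>K\<close> have compact images, so an open \<open>U\<close> extends to the complement in
  \<open>Y\<close> of the image of \<open>K - U\<close>; the complement of the image of
  \<open>K\<close> completes the cover of \<open>Y\<close>.\<close>

lemma covering_dim_le_pullback:
  fixes g :: "'a::t2_space \<Rightarrow> 'b::t2_space"
  assumes K: "compact K" and g: "continuous_on K g" "inj_on g K" "g ` K \<subseteq> Y"
    and dim: "covering_dim_le (top_of_set Y) d"
  shows "covering_dim_le (top_of_set K) d"
  unfolding covering_dim_le_def
proof (intro allI impI, elim conjE)
  fix \<U> assume fin: "finite \<U>" and \<U>: "open_cover_of \<U> (top_of_set K)"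
  define \<U>' where "\<U>' = insert (Y - g ` K) ((\<lambda>U. Y - g ` (K - U)) ` \<U>)"
  have ope: "openin (top_of_set Y) (Y - g ` C)" if "C \<subseteq> K" "closedin (top_of_set K) C" for C
  proof -
    have "compact C"
      using K that closedin_compact by blast
    then have "closed (g ` C)"
      using that g(1) by (meson compact_continuous_image compact_imp_closed continuous_on_subset)
    then show ?thesis by (metis Diff_eq open_Compl openin_open_Int)
  qed
  have opU: "openin (top_of_set K) U" if "U \<in> \<U>" for U
    using \<U> that by (simp add: open_cover_of_def)
  have "openin (top_of_set Y) U" if "U \<in> \<U>'" for U
    using that unfolding \<U>'_def by (auto intro!: ope opU closedin_diff)
  moreover have "\<Union>\<U>' = Y"
  proof
    show "Y \<subseteq> \<Union>\<U>'"
    proof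
      fix y assume y: "y \<in> Y"
      show "y \<in> \<Union>\<U>'"
      proof (cases "y \<in> g ` K")
        case True
        then obtain x where x: "x \<in> K" "y = g x" by blast
        then obtain U where U: "U \<in> \<U>" "x \<in> U" using \<U> by (auto simp: open_cover_of_def)
        have "y \<notin> g ` (K - U)" using x U g(2) by (auto dest: inj_onD)
        then show ?thesis using U y by (auto simp: \<U>'_def)
      qed (use y in \<open>simp add: \<U>'_def\<close>)
    qed
  qed (auto simp: \<U>'_def)
  ultimately have "open_cover_of \<U>' (top_of_set Y)" by (simp add: open_cover_of_def)
  moreover have "finite \<U>'" using fin by (simp add: \<U>'_def)
  ultimately
  obtain \<V>' where \<V>': "finite \<V>'" "open_cover_of \<V>' (top_of_set Y)"
    "\<forall>V\<in>\<V>'. \<exists>U\<in>\<U>'. V \<subseteq> U" "\<forall>\<F>. \<F> \<subseteq> \<V>' \<and> card \<F> = d + 2 \<longrightarrow> \<Inter>\<F> = {}"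
    by (rule covering_dim_leE[OF dim])
  define pb where "pb V = K \<inter> g -` V" for V
  \<comment> \<open>A member of \<open>\<V>'\<close> contained only in the complement of the image
    of \<open>K\<close> corresponds to no member of \<open>\<U>\<close>; its preimage is empty and
    is dropped.\<close>
  define \<V> where "\<V> = pb ` \<V>' - {{}}"
  have "open_cover_of \<V> (top_of_set K)"
    unfolding open_cover_of_def
  proof (intro conjI ballI)
    fix V assume "V \<in> \<V>"
    then obtain V' where "V' \<in> \<V>'" "V = K \<inter> g -` V'" by (auto simp: \<V>_def pb_def)
    moreover have "g \<in> K \<rightarrow> Y" using g(3) by auto
    ultimately show "openin (top_of_set K) V"
      using \<V>'(2) continuous_openin_preimage[OF g(1)] by (auto simp: open_cover_of_def)
  next
    have "x \<in> \<Union>\<V>" if "x \<in> K" for x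
    proof -
      have "\<Union>\<V>' = Y" using \<V>'(2) by (simp add: open_cover_of_def)
      then obtain V where "V \<in> \<V>'" "g x \<in> V" using g(3) \<open>x \<in> K\<close> by blast
      then have "pb V \<in> \<V>" "x \<in> pb V" using \<open>x \<in> K\<close> by (auto simp: \<V>_def pb_def)
      then show ?thesis by blast
    qed
    then show "\<Union>\<V> = topspace (top_of_set K)" by (auto simp: \<V>_def pb_def)
  qed
  moreover have "\<exists>U\<in>\<U>. V \<subseteq> U" if V: "V \<in> \<V>" for V
  proof -
    obtain V' where V': "V' \<in> \<V>'" "V = pb V'" "V \<noteq> {}" using V by (auto simp: \<V>_def)
    then obtain U' where U': "U' \<in> \<U>'" "V' \<subseteq> U'" using \<V>'(3) by blast
    moreover have "U' \<noteq> Y - g ` K" using V' U' by (auto simp: pb_def)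
    ultimately obtain U where "U \<in> \<U>" "U' = Y - g ` (K - U)" by (auto simp: \<U>'_def)
    then have "U \<in> \<U>" "V \<subseteq> U" using V'(2) U'(2) by (auto simp: pb_def)
    then show ?thesis by blast
  qed
  moreover have "\<Inter>\<F> = {}" if \<F>: "\<F> \<subseteq> \<V>" "card \<F> = d + 2" for \<F>
  proof -
    have "\<F> \<subseteq> pb ` \<V>'" using \<F>(1) by (auto simp: \<V>_def)
    \<comment> \<open>Different members of \<open>\<V>'\<close> may have the same preimage; choosing
      one for each element of \<open>\<F>\<close> preserves the cardinality.\<close>
    then obtain \<G> where \<G>: "\<G> \<subseteq> \<V>'" "inj_on pb \<G>" "\<F> = pb ` \<G>"
      by (meson subset_image_inj)
    then have "card \<G> = d + 2" using \<F>(2) by (simp add: card_image)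
    then have "\<Inter>\<G> = {}" using \<V>'(4) \<G>(1) by blast
    then show ?thesis by (auto simp: \<G>(3) pb_def)
  qed
  moreover have "finite \<V>" using \<V>'(1) by (simp add: \<V>_def)
  ultimately show "\<exists>\<V>. finite \<V> \<and> open_cover_of \<V> (top_of_set K) \<and> (\<forall>V\<in>\<V>. \<exists>U\<in>\<U>. V \<subseteq> U) \<and>
      (\<forall>\<F>. \<F> \<subseteq> \<V> \<and> card \<F> = d + 2 \<longrightarrow> \<Inter>\<F> = {})"
    by blast
qed

text \<open>Functions \<open>\<phi> V\<close> positive exactly on the members of a cover of order \<open>d + 1\<close> yield, for each
  \<open>k \<le> d\<close>, a disjoint family of open sets \<open>{\<psi> S > 0}\<close>, \<open>card S = k + 1\<close>: the points where
  the \<open>\<phi> V\<close> with \<open>V \<in> S\<close> dominate all others. Together these families cover \<open>F\<close>, and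
  the sign of \<open>u k\<close> may be chosen independently on each member of the \<open>k\<close>-th one.\<close>

lemma covering_dim_sign_functions:
  fixes F :: "'a::metric_space set" and A B :: "nat \<Rightarrow> 'a set"
  assumes F: "closed F" and dim: "covering_dim_le (top_of_set F) d"
    and AB: "\<And>k. k \<le> d \<Longrightarrow> closed (A k)" "\<And>k. k \<le> d \<Longrightarrow> closed (B k)"
      "\<And>k. k \<le> d \<Longrightarrow> A k \<inter> B k = {}"
  shows "\<exists>u :: nat \<Rightarrow> 'a \<Rightarrow> real. (\<forall>k. continuous_on F (u k)) \<and>
    (\<forall>k\<le>d. \<forall>x\<in>F \<inter> A k. u k x \<le> 0) \<and> (\<forall>k\<le>d. \<forall>x\<in>F \<inter> B k. u k x \<ge> 0) \<and>
    (\<forall>x\<in>F. \<exists>k\<le>d. u k x \<noteq> 0)"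
proof -
  \<comment> \<open>Each \<open>Us s\<close> misses \<open>A k\<close> for \<open>k\<close> in
    \<open>s\<close> and \<open>B k\<close> for the other \<open>k \<le> d\<close>, so no member of
    a refinement meets both sets of a pair.\<close>
  define Us where "Us s = F - ((\<Union>k\<in>s. A k) \<union> (\<Union>k\<in>{..d}-s. B k))" for s
  have op: "openin (top_of_set F) (Us s)" if "s \<subseteq> {..d}" for s
  proof -
    have "closed ((\<Union>k\<in>s. A k) \<union> (\<Union>k\<in>{..d}-s. B k))"
      using that AB(1,2) finite_subset[OF that]
      by (intro closed_Un closed_UN ballI) (auto simp: subset_iff)
    then show ?thesis unfolding Us_def by (metis Diff_eq open_Compl openin_open_Int)
  qed
  have "\<Union>(Us ` Pow {..d}) = F"
  proof
    show "F \<subseteq> \<Union>(Us ` Pow {..d})"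
    proof
      fix x assume x: "x \<in> F"
      have "x \<in> Us {k. k \<le> d \<and> x \<notin> A k}" using x AB(3) by (auto simp: Us_def)
      then show "x \<in> \<Union>(Us ` Pow {..d})" by (intro UnionI[OF imageI]) auto
    qed
  qed (auto simp: Us_def)
  then have "open_cover_of (Us ` Pow {..d}) (top_of_set F)"
    using op by (auto simp: open_cover_of_def)
  moreover have "finite (Us ` Pow {..d})" by simp
  ultimately obtain \<V> where \<V>: "finite \<V>" "open_cover_of \<V> (top_of_set F)"
    "\<forall>V\<in>\<V>. \<exists>U\<in>Us ` Pow {..d}. V \<subseteq> U" "\<forall>\<F>. \<F> \<subseteq> \<V> \<and> card \<F> = d + 2 \<longrightarrow> \<Inter>\<F> = {}"
    by (rule covering_dim_leE[OF dim])
  \<comment> \<open>\<open>infdist\<close> to the empty set is 0, so a member containing all of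
    \<open>F\<close> needs a positive value by hand.\<close>
  define \<phi> where "\<phi> V x = (if F - V = {} then 1 else infdist x (F - V))" for V x
  have \<phi>_cont: "continuous_on T (\<phi> V)" for T V
    unfolding \<phi>_def by (cases "F - V = {}") (simp_all add: continuous_on_infdist continuous_on_id)
  have \<phi>_nonneg: "\<phi> V x \<ge> 0" for V x by (simp add: \<phi>_def infdist_nonneg)
  have \<phi>_pos: "\<phi> V x > 0 \<longleftrightarrow> x \<in> V" if "V \<in> \<V>" "x \<in> F" for V x
  proof (cases "F - V = {}")
    case False
    have "openin (top_of_set F) V"
      using \<V>(2) that(1) by (simp add: open_cover_of_def)
    then have "closedin (top_of_set F) (F - V)"
      by (metis closedin_diff closedin_topspace topspace_euclidean_subtopology)
    then have "closed (F - V)" using F closedin_closed_trans by blast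
    then show ?thesis using that False in_closed_iff_infdist_zero[of "F - V" x] infdist_nonneg[of x "F - V"]
      by (auto simp: \<phi>_def less_le)
  qed (use that in \<open>auto simp: \<phi>_def\<close>)
  define \<psi> where "\<psi> S x = (\<Prod>V\<in>S. \<phi> V x * (\<Prod>W\<in>\<V>-S. max 0 (\<phi> V x - \<phi> W x)))" for S x
  have fin: "finite S" if "S \<subseteq> \<V>" for S using that \<V>(1) finite_subset by blast
  have \<psi>_nonneg: "\<psi> S x \<ge> 0" for S x
    unfolding \<psi>_def by (intro prod_nonneg mult_nonneg_nonneg \<phi>_nonneg) simp
  have \<psi>_pos: "\<psi> S x > 0 \<longleftrightarrow> (\<forall>V\<in>S. x \<in> V \<and> (\<forall>W\<in>\<V>-S. \<phi> V x > \<phi> W x))"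
    if "S \<subseteq> \<V>" "x \<in> F" for S x
  proof -
    have "\<psi> S x > 0 \<longleftrightarrow> \<psi> S x \<noteq> 0" using \<psi>_nonneg[of S x] by linarith
    also have "\<dots> \<longleftrightarrow> (\<forall>V\<in>S. \<phi> V x \<noteq> 0 \<and> (\<forall>W\<in>\<V>-S. max 0 (\<phi> V x - \<phi> W x) \<noteq> 0))"
      using fin[OF that(1)] \<V>(1) by (simp add: \<psi>_def)
    also have "\<dots> \<longleftrightarrow> (\<forall>V\<in>S. x \<in> V \<and> (\<forall>W\<in>\<V>-S. \<phi> V x > \<phi> W x))"
      using that(1) \<phi>_pos[OF _ that(2)] \<phi>_nonneg
      by (intro ball_cong refl conj_cong) (auto simp: less_le max_def)
    finally show ?thesis .
  qed
  define fam where "fam k = {S. S \<subseteq> \<V> \<and> card S = Suc k}" for k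
  \<comment> \<open>If the intersection of \<open>S\<close> meets \<open>A k\<close>, it misses
    \<open>B k\<close>, because a single \<open>V\<close> in \<open>S\<close> cannot meet both; a
    negative sign is then safe.\<close>
  define \<epsilon> where "\<epsilon> k S = (if A k \<inter> \<Inter>S = {} then 1 else - 1 :: real)" for k S
  define u where "u k x = (\<Sum>S\<in>fam k. \<epsilon> k S * \<psi> S x)" for k x
  have fin_fam: "finite (fam k)" for k
    unfolding fam_def using \<V>(1) by (auto intro: finite_subset[of _ "Pow \<V>"])
  show ?thesis
  proof (intro exI[of _ u] conjI allI ballI impI)
    show "continuous_on F (u k)" for k
      unfolding u_def \<psi>_def by (intro continuous_on_sum continuous_on_mult continuous_on_prod
          continuous_on_max continuous_on_diff continuous_on_const \<phi>_cont)
  next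
    fix k x assume k: "k \<le> d" and x: "x \<in> F \<inter> A k"
    have "\<epsilon> k S * \<psi> S x \<le> 0" if S: "S \<in> fam k" for S
    proof (cases "\<psi> S x > 0")
      case True
      then have "x \<in> \<Inter>S" using \<psi>_pos[of S x] S x by (auto simp: fam_def)
      then have "\<epsilon> k S = -1" using x by (auto simp: \<epsilon>_def)
      then show ?thesis using \<psi>_nonneg by simp
    next
      case False
      then show ?thesis using \<psi>_nonneg[of S x] by simp
    qed
    then show "u k x \<le> 0" unfolding u_def by (rule sum_nonpos)
  next
    fix k x assume k: "k \<le> d" and x: "x \<in> F \<inter> B k"
    have "\<epsilon> k S * \<psi> S x \<ge> 0" if S: "S \<in> fam k" for S
    proof (cases "\<psi> S x > 0")
      case True
      then have xS: "x \<in> \<Inter>S" using \<psi>_pos[of S x] S x by (auto simp: fam_def)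
      have "S \<noteq> {}" "S \<subseteq> \<V>" using S by (auto simp: fam_def)
      then obtain V where V: "V \<in> S" "V \<in> \<V>" by blast
      then obtain s where s: "s \<subseteq> {..d}" "V \<subseteq> Us s" using \<V>(3) by blast
      have "x \<in> Us s" using xS V(1) s(2) by blast
      then have "k \<in> s" using x k by (auto simp: Us_def)
      then have "A k \<inter> V = {}" using s(2) by (auto simp: Us_def)
      then have "\<epsilon> k S = 1" using V(1) by (auto simp: \<epsilon>_def)
      then show ?thesis using \<psi>_nonneg by simp
    next
      case False
      then show ?thesis using \<psi>_nonneg[of S x] by simp
    qed
    then show "u k x \<ge> 0" unfolding u_def by (rule sum_nonneg)
  next
    fix x assume x: "x \<in> F"
    then obtain V0 where V0: "V0 \<in> \<V>" "x \<in> V0" using \<V>(2) by (auto simp: open_cover_of_def)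
    define m where "m = Max ((\<lambda>V. \<phi> V x) ` \<V>)"
    have le_m: "\<phi> V x \<le> m" if "V \<in> \<V>" for V using that \<V>(1) by (simp add: m_def)
    have m_pos: "m > 0" using le_m[OF V0(1)] \<phi>_pos[OF V0(1) x] V0(2) by linarith
    \<comment> \<open>The members maximal at \<open>x\<close> all contain \<open>x\<close>, so there
      are at most \<open>d + 1\<close> of them. For another \<open>T\<close> of the same size, a
      member outside \<open>S\<close> would have to exceed one in \<open>S\<close>; hence only the
      term of \<open>S\<close> survives in \<open>u k x\<close>.\<close>
    define S where "S = {V \<in> \<V>. \<phi> V x = m}"
    have S\<V>: "S \<subseteq> \<V>" by (auto simp: S_def)
    have "m \<in> (\<lambda>V. \<phi> V x) ` \<V>" unfolding m_def using \<V>(1) V0(1) by (intro Max_in) auto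
    then have "S \<noteq> {}" by (auto simp: S_def)
    then have card_pos: "card S > 0" using fin[OF S\<V>] by (simp add: card_gt_0_iff)
    have xS: "x \<in> V" if "V \<in> S" for V
      using that \<phi>_pos[of V x] x m_pos by (auto simp: S_def)
    have "card S < d + 2"
    proof (rule ccontr)
      assume "\<not> card S < d + 2"
      then obtain T where "T \<subseteq> S" "card T = d + 2"
        using obtain_subset_with_card_n[of "d + 2" S] by auto
      then have "\<Inter>T = {}" using \<V>(4) S\<V> by blast
      then show False using xS \<open>T \<subseteq> S\<close> by blast
    qed
    define k where "k = card S - 1"
    have k: "k \<le> d" "S \<in> fam k" using \<open>card S < d + 2\<close> card_pos S\<V> by (auto simp: k_def fam_def)
    have S_pos: "\<psi> S x > 0"
      using \<psi>_pos[OF S\<V> x] xS le_m by (auto simp: S_def less_le)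
    have "\<psi> T x = 0" if T: "T \<in> fam k - {S}" for T
    proof (rule ccontr)
      assume "\<psi> T x \<noteq> 0"
      then have pos: "\<psi> T x > 0" using \<psi>_nonneg[of T x] by linarith
      have TV: "T \<subseteq> \<V>" "card T = card S" "T \<noteq> S" using T k(2) by (auto simp: fam_def)
      then have "\<not> T \<subseteq> S" "\<not> S \<subseteq> T"
        using card_subset_eq[OF fin[OF S\<V>], of T] card_subset_eq[OF fin[OF TV(1)], of S] by auto
      then obtain V W where VW: "V \<in> T" "V \<notin> S" "W \<in> S" "W \<notin> T" by blast
      then have "\<phi> W x < \<phi> V x" using pos \<psi>_pos[OF TV(1) x] S\<V> by blast
      moreover have "\<phi> V x \<le> \<phi> W x" using VW le_m TV(1) by (auto simp: S_def)
      ultimately show False by simp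
    qed
    then have "u k x = \<epsilon> k S * \<psi> S x"
      using fin_fam k(2) by (simp add: u_def sum.remove[of _ S])
    then have "u k x \<noteq> 0" using S_pos by (simp add: \<epsilon>_def)
    then show "\<exists>k\<le>d. u k x \<noteq> 0" using k(1) by blast
  qed
qed

text \<open>The zero sets of the \<open>u k\<close> have no common point in \<open>F\<close>. The
  parts of \<open>F\<close> with \<open>u k \<le> 0\<close> and \<open>u k \<ge> 0\<close>, joined
  with \<open>A k\<close> and \<open>B k\<close>, are closed, and comparing the distances to them
  extends the splitting to the whole space. Nonemptiness ensures that distance 0 means
  membership.\<close>

lemma covering_dim_inessential:
  fixes F :: "'a::metric_space set" and A B :: "nat \<Rightarrow> 'a set"
  assumes F: "closed F" and dim: "covering_dim_le (top_of_set F) d"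
    and AB: "\<And>k. k \<le> d \<Longrightarrow> closed (A k)" "\<And>k. k \<le> d \<Longrightarrow> closed (B k)"
      "\<And>k. k \<le> d \<Longrightarrow> A k \<inter> B k = {}" "\<And>k. k \<le> d \<Longrightarrow> A k \<noteq> {}" "\<And>k. k \<le> d \<Longrightarrow> B k \<noteq> {}"
  obtains P R
  where "\<And>k. k \<le> d \<Longrightarrow> closed (P k)" "\<And>k. k \<le> d \<Longrightarrow> closed (R k)"
    "\<And>k. k \<le> d \<Longrightarrow> P k \<union> R k = UNIV"
    "\<And>k. k \<le> d \<Longrightarrow> A k \<subseteq> P k" "\<And>k. k \<le> d \<Longrightarrow> B k \<subseteq> R k"
    "\<And>x. x \<in> F \<Longrightarrow> \<exists>k\<le>d. x \<notin> P k \<inter> R k"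
proof -
  obtain u :: "nat \<Rightarrow> 'a \<Rightarrow> real" where u: "\<forall>k. continuous_on F (u k)"
    "\<forall>k\<le>d. \<forall>x\<in>F \<inter> A k. u k x \<le> 0" "\<forall>k\<le>d. \<forall>x\<in>F \<inter> B k. u k x \<ge> 0"
    "\<forall>x\<in>F. \<exists>k\<le>d. u k x \<noteq> 0"
  proof -
    have "\<exists>u :: nat \<Rightarrow> 'a \<Rightarrow> real. (\<forall>k. continuous_on F (u k)) \<and>
        (\<forall>k\<le>d. \<forall>x\<in>F \<inter> A k. u k x \<le> 0) \<and> (\<forall>k\<le>d. \<forall>x\<in>F \<inter> B k. u k x \<ge> 0) \<and>
        (\<forall>x\<in>F. \<exists>k\<le>d. u k x \<noteq> 0)"
      by (rule covering_dim_sign_functions[OF F dim]) (fact AB)+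
    then show thesis using that by (elim exE conjE)
  qed
  define P0 where "P0 k = A k \<union> {x \<in> F. u k x \<le> 0}" for k
  define R0 where "R0 k = B k \<union> {x \<in> F. 0 \<le> u k x}" for k
  have "closed (F \<inter> u k -` {..0})" "closed (F \<inter> u k -` {0..})" for k
    by (auto intro!: continuous_closed_preimage u(1)[rule_format] F)
  moreover have "F \<inter> u k -` {..0} = {x \<in> F. u k x \<le> 0}" "F \<inter> u k -` {0..} = {x \<in> F. 0 \<le> u k x}" for k
    by auto
  ultimately have cl: "closed (P0 k)" "closed (R0 k)" if "k \<le> d" for k
    unfolding P0_def R0_def using AB(1,2)[OF that] by (simp_all add: closed_Un)
  have ne: "P0 k \<noteq> {}" "R0 k \<noteq> {}" if "k \<le> d" for k
    using AB that by (auto simp: P0_def R0_def)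
  show thesis
  proof (rule that[of "\<lambda>k. {x. infdist x (P0 k) \<le> infdist x (R0 k)}" "\<lambda>k. {x. infdist x (R0 k) \<le> infdist x (P0 k)}"])
    fix k
    show "closed {x. infdist x (P0 k) \<le> infdist x (R0 k)}" "closed {x. infdist x (R0 k) \<le> infdist x (P0 k)}"
      by (intro closed_Collect_le continuous_intros)+
    show "{x. infdist x (P0 k) \<le> infdist x (R0 k)} \<union> {x. infdist x (R0 k) \<le> infdist x (P0 k)} = UNIV"
      by auto
    show "A k \<subseteq> {x. infdist x (P0 k) \<le> infdist x (R0 k)}"
      by (auto simp: P0_def infdist_nonneg)
    show "B k \<subseteq> {x. infdist x (R0 k) \<le> infdist x (P0 k)}"
      by (auto simp: R0_def infdist_nonneg)
  next
    fix x assume x: "x \<in> F"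
    then obtain k where k: "k \<le> d" "u k x \<noteq> 0" using u(4) by blast
    have "\<not> (x \<in> P0 k \<and> x \<in> R0 k)"
      using u(2,3)[rule_format, OF k(1), of x] k AB(3)[OF k(1)] x unfolding P0_def R0_def by force
    moreover have "x \<in> P0 k \<or> x \<in> R0 k" using x by (auto simp: P0_def R0_def)
    ultimately have "infdist x (P0 k) \<noteq> infdist x (R0 k)"
      using in_closed_iff_infdist_zero[OF cl(1) ne(1)] in_closed_iff_infdist_zero[OF cl(2) ne(2)] k(1)
      by metis
    then show "\<exists>k\<le>d. x \<notin> {x. infdist x (P0 k) \<le> infdist x (R0 k)} \<inter> {x. infdist x (R0 k) \<le> infdist x (P0 k)}"
      using k(1) by auto
  qed
qed

section \<open>Finite-dimensional subsets of the Hilbert cube\<close>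

text \<open>A separation counts as one more pair besides the \<open>d + 1\<close> pairs that can be
  split on \<open>F\<close>. A cube of dimension \<open>d + 2\<close> is mapped into the Hilbert
  cube so that one coordinate leads from \<open>U\<close> to \<open>V\<close>; the opposite faces
  theorem then yields a point of \<open>F\<close> in every \<open>P k\<close> and
  \<open>R k\<close>, which \<open>covering_dim_inessential\<close> excludes.\<close>

lemma connected_hilbert_cube_diff_finite_dimensional:
  assumes F: "closed F" and dim: "covering_dim_le (top_of_set F) d"
  shows "connected (hilbert_cube - F)"
proof (rule ccontr)
  assume "\<not> connected (hilbert_cube - F)"
  then obtain U V where UV: "open U" "open V" "hilbert_cube - F \<subseteq> U \<union> V"
    "U \<inter> V \<inter> (hilbert_cube - F) = {}" "U \<inter> (hilbert_cube - F) \<noteq> {}" "V \<inter> (hilbert_cube - F) \<noteq> {}"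
    unfolding connected_def by metis
  obtain z p where z: "z \<in> U - F" "z \<in> hilbert_cube" and p: "p \<in> V - F" "p \<in> hilbert_cube"
    using UV(5,6) by blast
  have opUV: "open (U - F)" "open (V - F)" using UV(1,2) F by auto
  obtain N1 e1 where N1: "e1 > 0" "\<And>x. (\<And>i. i < N1 \<Longrightarrow> \<bar>x i - z i\<bar> \<le> e1) \<Longrightarrow> x \<in> U - F"
    using open_contains_coordinate_box[OF opUV(1) z(1)] by metis
  obtain N2 e2 where N2: "e2 > 0" "\<And>x. (\<And>i. i < N2 \<Longrightarrow> \<bar>x i - p i\<bar> \<le> e2) \<Longrightarrow> x \<in> V - F"
    using open_contains_coordinate_box[OF opUV(2) p(1)] by metis
  define N where "N = max N1 N2"
  have inU: "x \<in> U - F" if "\<And>i. i < N \<Longrightarrow> x i = z i" for x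
    by (rule N1(2)) (use that N1(1) in \<open>simp add: N_def\<close>)
  have inV: "x \<in> V - F" if "\<And>i. i < N \<Longrightarrow> x i = p i" for x
    by (rule N2(2)) (use that N2(1) in \<open>simp add: N_def\<close>)
  \<comment> \<open>The first \<open>N\<close> coordinates decide nearness to \<open>z\<close> and
    to \<open>p\<close>, so \<open>t 0\<close> moves just these along the segment between them. The
    others stay free: coordinate \<open>N + k\<close> is \<open>t (Suc k)\<close>.\<close>
  define h :: "(nat \<Rightarrow> real) \<Rightarrow> nat \<Rightarrow> real"
    where "h t i = (if i < N then (1 - t 0) * z i + t 0 * p i else t (Suc (i - N)))" for t i
  have h_cont: "continuous_on UNIV h"
  proof (rule continuous_on_coordinatewise_then_product)
    fix i show "continuous_on UNIV (\<lambda>t. h t i)"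
      by (cases "i < N") (auto simp: h_def intro!: continuous_on_add continuous_on_mult continuous_on_diff continuous_on_const)
  qed
  have h_cube: "h t \<in> hilbert_cube" if "t \<in> hilbert_cube" for t
    unfolding hilbert_cube_iff
  proof
    fix i
    have "t 0 \<ge> 0" "t 0 \<le> 1" using that by (auto simp: hilbert_cube_iff)
    moreover have "0 \<le> z i" "z i \<le> 1" "0 \<le> p i" "p i \<le> 1" using z p by (auto simp: hilbert_cube_iff)
    ultimately have "0 \<le> (1 - t 0) * z i + t 0 * p i" "(1 - t 0) * z i + t 0 * p i \<le> 1"
      using convex_bound_le[of "z i" 1 "p i" "1 - t 0" "t 0"] by auto
    then show "0 \<le> h t i \<and> h t i \<le> 1" using that by (simp add: h_def hilbert_cube_iff)
  qed
  obtain P R where PR: "\<And>k. k \<le> d \<Longrightarrow> closed (P k)" "\<And>k. k \<le> d \<Longrightarrow> closed (R k)"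
    "\<And>k. k \<le> d \<Longrightarrow> P k \<union> R k = UNIV"
    "\<And>k. k \<le> d \<Longrightarrow> {x. x (N + k) = 0} \<subseteq> P k" "\<And>k. k \<le> d \<Longrightarrow> {x. x (N + k) = 1} \<subseteq> R k"
    "\<And>x. x \<in> F \<Longrightarrow> \<exists>k\<le>d. x \<notin> P k \<inter> R k"
  proof (rule covering_dim_inessential[OF F dim, where A = "\<lambda>k. {x. x (N + k) = 0}" and B = "\<lambda>k. {x. x (N + k) = 1}"])
    fix k
    show "closed {x::nat \<Rightarrow> real. x (N + k) = 0}" "closed {x::nat \<Rightarrow> real. x (N + k) = 1}"
      by (intro closed_Collect_eq continuous_on_product_coordinates continuous_on_const)+
    show "{x::nat \<Rightarrow> real. x (N + k) = 0} \<noteq> {}" "{x::nat \<Rightarrow> real. x (N + k) = 1} \<noteq> {}"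
      by (auto intro: exI[of _ "\<lambda>_. 0"] exI[of _ "\<lambda>_. 1"])
  qed auto
  \<comment> \<open>Pair 0 is the separation itself: a point of both \<open>P' 0\<close> and
    \<open>R' 0\<close> is mapped off both sides, hence into \<open>F\<close>.\<close>
  define P' where "P' i = (case i of 0 \<Rightarrow> h -` (- (V - F)) | Suc k \<Rightarrow> h -` P k)" for i
  define R' where "R' i = (case i of 0 \<Rightarrow> h -` (- (U - F)) | Suc k \<Rightarrow> h -` R k)" for i
  have cl: "closed (h -` C)" if "closed C" for C
    using that h_cont by (simp add: closed_vimage)
  have "\<exists>t\<in>hilbert_cube. \<forall>i<Suc (Suc d). t \<in> P' i \<and> t \<in> R' i"
  proof (rule hilbert_cube_opposite_faces)
    fix i assume "i < Suc (Suc d)"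
    then show "closed (P' i)" "closed (R' i)"
      using cl opUV PR(1,2) by (auto simp: P'_def R'_def closed_Compl simp del: vimage_Compl Compl_Diff_eq split: nat.split)
  next
    fix i t assume i: "i < Suc (Suc d)" and t: "t \<in> hilbert_cube"
    show "t \<in> P' i \<or> t \<in> R' i"
    proof (cases i)
      case 0
      then show ?thesis using UV(4) h_cube[OF t] by (auto simp: P'_def R'_def)
    next
      case (Suc k)
      then show ?thesis using i PR(3)[of k] by (auto simp: P'_def R'_def)
    qed
    show "t \<in> P' i" if "t i = 0"
    proof (cases i)
      case 0
      then have "h t \<in> U - F" using that by (intro inU) (simp add: h_def)
      then show ?thesis using UV(4) h_cube[OF t] 0 by (auto simp: P'_def)
    next
      case (Suc k)
      then have "h t \<in> P k" using i that PR(4)[of k] by (auto simp: h_def subset_iff)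
      then show ?thesis by (simp add: P'_def Suc)
    qed
    show "t \<in> R' i" if "t i = 1"
    proof (cases i)
      case 0
      then have "h t \<in> V - F" using that by (intro inV) (simp add: h_def)
      then show ?thesis using UV(4) h_cube[OF t] 0 by (auto simp: R'_def)
    next
      case (Suc k)
      then have "h t \<in> R k" using i that PR(5)[of k] by (auto simp: h_def subset_iff)
      then show ?thesis by (simp add: R'_def Suc)
    qed
  qed
  then obtain t where t: "t \<in> hilbert_cube" "\<forall>i<Suc (Suc d). t \<in> P' i \<and> t \<in> R' i" by blast
  have "h t \<notin> V - F" "h t \<notin> U - F"
    using t(2)[rule_format, of 0] by (simp_all add: P'_def R'_def)
  then have "h t \<in> F" using UV(3) h_cube[OF t(1)] by blast
  then obtain k where k: "k \<le> d" "h t \<notin> P k \<inter> R k" using PR(6) by blast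
  have "t \<in> P' (Suc k)" "t \<in> R' (Suc k)" using t(2) k(1) by auto
  then show False using k(2) by (simp add: P'_def R'_def)
qed

text \<open>A nonzero point of this set with a coordinate \<open>x i > 0\<close> vanishes at all coordinates
  \<open>j\<close> with \<open>j + 1 > 1 / x i\<close>; the set consists of the cubes \<open>[0, 1/n]\<^sup>n\<close>,
  \<open>n \<ge> 1\<close>, which shrink to the origin.\<close>

definition shrinking_cubes :: "(nat \<Rightarrow> real) set" where
  "shrinking_cubes = {x \<in> hilbert_cube. \<forall>i j. x j = 0 \<or> x i * real (Suc j) \<le> 1}"

lemma shrinking_cubes_subset: "shrinking_cubes \<subseteq> hilbert_cube"
  by (auto simp: shrinking_cubes_def)

lemma zero_in_shrinking_cubes: "(\<lambda>_. 0) \<in> shrinking_cubes"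
  by (auto simp: shrinking_cubes_def hilbert_cube_iff)

lemma closed_shrinking_cubes: "closed shrinking_cubes"
proof -
  have "closed {x::nat \<Rightarrow> real. x j = 0 \<or> x i * real (Suc j) \<le> 1}" for i j
    by (intro closed_Collect_disj closed_Collect_eq closed_Collect_le continuous_on_mult
        continuous_on_product_coordinates continuous_on_const)
  moreover have "shrinking_cubes = hilbert_cube \<inter> (\<Inter>i. \<Inter>j. {x. x j = 0 \<or> x i * real (Suc j) \<le> 1})"
    by (auto simp: shrinking_cubes_def)
  ultimately show ?thesis
    using closed_hilbert_cube by (metis (no_types, lifting) closed_INT closed_Int)
qed

lemma finite_support_shrinking_cubes:
  assumes "x \<in> shrinking_cubes"
  shows "finite {i. x i \<noteq> 0}"
proof (cases "\<exists>i. x i \<noteq> 0")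
  case True
  then obtain i where "x i \<noteq> 0" by blast
  then have i: "x i > 0" using assms by (auto simp: shrinking_cubes_def hilbert_cube_iff less_le)
  obtain n where n: "1 < real n * x i" using reals_Archimedean3[OF i] by blast
  have "j < n" if "x j \<noteq> 0" for j
  proof (rule ccontr)
    assume "\<not> j < n"
    then have "real n * x i \<le> x i * real (Suc j)" using i by (simp add: mult.commute)
    moreover have "x i * real (Suc j) \<le> 1" using that assms by (auto simp: shrinking_cubes_def)
    ultimately show False using n by linarith
  qed
  then have "{i. x i \<noteq> 0} \<subseteq> {..<n}" by auto
  then show ?thesis using finite_subset by blast
qed simp

text \<open>The set contains a cube of dimension \<open>d + 1\<close>, whose pairs of opposite faces
  cannot be split without a common point; on \<open>F\<close> they could be.\<close>

lemma shrinking_cubes_not_subset_finite_dimensional: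
  assumes F: "closed F" and dim: "covering_dim_le (top_of_set F) d"
  shows "\<not> shrinking_cubes \<subseteq> F"
proof
  assume sub: "shrinking_cubes \<subseteq> F"
  \<comment> \<open>The scale \<open>1 / real (Suc d)\<close> is the longest edge allowed for a cube
    in the coordinates up to \<open>d\<close>: the strictest condition is the one at
    \<open>j = d\<close>.\<close>
  define h :: "(nat \<Rightarrow> real) \<Rightarrow> nat \<Rightarrow> real"
    where "h t i = (if i \<le> d then t i / real (Suc d) else 0)" for t i
  have h_cont: "continuous_on UNIV h"
  proof (rule continuous_on_coordinatewise_then_product)
    fix i show "continuous_on UNIV (\<lambda>t. h t i)"
      by (cases "i \<le> d") (auto simp: h_def intro!: continuous_on_divide continuous_on_const)
  qed
  have h_in: "h t \<in> shrinking_cubes" if t: "t \<in> hilbert_cube" for t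
  proof -
    have le: "0 \<le> h t i \<and> h t i \<le> 1 / real (Suc d)" for i
      using t by (auto simp: h_def hilbert_cube_iff intro!: divide_right_mono)
    have "h t i * real (Suc j) \<le> 1" if "h t j \<noteq> 0" for i j
    proof -
      have "real (Suc j) \<le> real (Suc d)" using that by (auto simp: h_def split: if_splits)
      then have "h t i * real (Suc j) \<le> 1 / real (Suc d) * real (Suc d)"
        using le[of i] by (intro mult_mono) auto
      then show ?thesis by simp
    qed
    moreover have "h t i \<le> 1" for i
      using le[of i] by (rule order_trans[OF conjunct2]) simp
    ultimately show ?thesis using le by (auto simp: shrinking_cubes_def hilbert_cube_iff)
  qed
  obtain P R where PR: "\<And>k. k \<le> d \<Longrightarrow> closed (P k)" "\<And>k. k \<le> d \<Longrightarrow> closed (R k)"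
    "\<And>k. k \<le> d \<Longrightarrow> P k \<union> R k = UNIV"
    "\<And>k. k \<le> d \<Longrightarrow> {x. x k = 0} \<subseteq> P k" "\<And>k. k \<le> d \<Longrightarrow> {x. x k = 1 / real (Suc d)} \<subseteq> R k"
    "\<And>x. x \<in> F \<Longrightarrow> \<exists>k\<le>d. x \<notin> P k \<inter> R k"
  proof (rule covering_dim_inessential[OF F dim, where A = "\<lambda>k. {x. x k = 0}" and B = "\<lambda>k. {x. x k = 1 / real (Suc d)}"])
    fix k
    show "closed {x::nat \<Rightarrow> real. x k = 0}" "closed {x::nat \<Rightarrow> real. x k = 1 / real (Suc d)}"
      by (intro closed_Collect_eq continuous_on_product_coordinates continuous_on_const)+
    show "{x::nat \<Rightarrow> real. x k = 0} \<noteq> {}" "{x::nat \<Rightarrow> real. x k = 1 / real (Suc d)} \<noteq> {}"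
      by (auto intro: exI[of _ "\<lambda>_. 0"] exI[of _ "\<lambda>_. 1 / real (Suc d)"])
  qed auto
  have cl: "closed (h -` C)" if "closed C" for C
    using that h_cont by (simp add: closed_vimage)
  have "\<exists>t\<in>hilbert_cube. \<forall>i<Suc d. t \<in> h -` P i \<and> t \<in> h -` R i"
  proof (rule hilbert_cube_opposite_faces)
    fix i t assume i: "i < Suc d"
    show "t \<in> h -` P i \<or> t \<in> h -` R i" using PR(3)[of i] i by auto
    show "t \<in> h -` P i" if "t i = 0" using PR(4)[of i] i that by (auto simp: h_def subset_iff)
    show "t \<in> h -` R i" if "t i = 1" using PR(5)[of i] i that by (auto simp: h_def subset_iff)
  qed (auto intro!: cl PR(1,2))
  then obtain t where t: "t \<in> hilbert_cube" "\<forall>i<Suc d. h t \<in> P i \<and> h t \<in> R i" by auto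
  then show False using PR(6)[of "h t"] h_in[OF t(1)] sub by (auto simp: less_Suc_eq_le)
qed

section \<open>Continua in the Hilbert cube off a finite-dimensional closed set\<close>

lemma hilbert_cube_local_continuum:
  assumes "open O'" "x \<in> O'" "x \<in> hilbert_cube"
  obtains B W where "compact B" "connected B" "B \<subseteq> hilbert_cube \<inter> O'" "open W" "x \<in> W"
    "W \<inter> hilbert_cube \<subseteq> B"
proof -
  obtain N e where e: "e > 0" "\<And>y. (\<And>i. i < N \<Longrightarrow> \<bar>y i - x i\<bar> \<le> e) \<Longrightarrow> y \<in> O'"
    using open_contains_coordinate_box[OF assms(1,2)] by metis
  \<comment> \<open>Only coordinates below \<open>N\<close> are constrained, clipped to the unit
    interval; the box is an order interval, hence compact and connected.\<close>
  define a where "a i = (if i < N then max 0 (x i - e) else 0)" for i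
  define b where "b i = (if i < N then min 1 (x i + e) else 1)" for i
  show thesis
  proof (rule that[of "{a..b}" "{y. \<forall>i<N. \<bar>y i - x i\<bar> < e}"])
    have bd: "0 \<le> a i" "b i \<le> 1" for i by (auto simp: a_def b_def)
    show "{a..b} \<subseteq> hilbert_cube \<inter> O'"
    proof
      fix y assume "y \<in> {a..b}"
      then have y: "a i \<le> y i" "y i \<le> b i" for i by (auto simp: le_fun_def)
      have "\<bar>y i - x i\<bar> \<le> e" if "i < N" for i
        using y[of i] that by (simp add: a_def b_def abs_le_iff)
      moreover have "0 \<le> y i" "y i \<le> 1" for i using y[of i] bd[of i] by linarith+
      ultimately show "y \<in> hilbert_cube \<inter> O'" using e(2)[of y] by (simp add: hilbert_cube_iff)
    qed
    show "{y. \<forall>i<N. \<bar>y i - x i\<bar> < e} \<inter> hilbert_cube \<subseteq> {a..b}"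
    proof
      fix y assume y: "y \<in> {y. \<forall>i<N. \<bar>y i - x i\<bar> < e} \<inter> hilbert_cube"
      have "a i \<le> y i \<and> y i \<le> b i" for i
      proof -
        have "i < N \<Longrightarrow> \<bar>y i - x i\<bar> < e" "0 \<le> y i" "y i \<le> 1" using y by (auto simp: hilbert_cube_iff)
        then show ?thesis by (simp add: a_def b_def abs_less_iff) linarith
      qed
      then show "y \<in> {a..b}" by (simp add: le_fun_def)
    qed
  qed (use e(1) in \<open>auto simp: compact_fun_interval connected_fun_interval open_coordinate_box\<close>)
qed

text \<open>Being joined by a continuum off \<open>F\<close> is an equivalence relation, and box
  neighbourhoods make its classes open, so connectedness of the complement leaves only one class. A
  box around \<open>z\<close> is added to obtain a neighbourhood of \<open>z\<close> in the
  cube.\<close>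

lemma hilbert_cube_diff_continuum:
  assumes F: "closed F" and dim: "covering_dim_le (top_of_set F) d"
    and z: "z \<in> hilbert_cube - F" and p: "p \<in> hilbert_cube - F"
  obtains T W where "compact T" "connected T" "T \<subseteq> hilbert_cube - F" "p \<in> T"
    "open W" "z \<in> W" "W \<inter> hilbert_cube \<subseteq> T"
proof -
  define joined where
    "joined a b \<longleftrightarrow> (\<exists>T. compact T \<and> connected T \<and> T \<subseteq> hilbert_cube - F \<and> a \<in> T \<and> b \<in> T)" for a b
  have local: "\<exists>B W. compact B \<and> connected B \<and> B \<subseteq> hilbert_cube - F \<and> open W \<and> a \<in> W \<and> W \<inter> hilbert_cube \<subseteq> B"
    if a: "a \<in> hilbert_cube - F" for a
  proof -
    obtain B W where "compact B" "connected B" "B \<subseteq> hilbert_cube \<inter> - F" "open W" "a \<in> W" "W \<inter> hilbert_cube \<subseteq> B"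
      using hilbert_cube_local_continuum[of "- F" a] F a by auto
    then show ?thesis by (auto simp: Diff_eq)
  qed
  have "joined z p"
  proof (rule connected_equivalence_relation[where S = "hilbert_cube - F"])
    show "connected (hilbert_cube - F)"
      by (rule connected_hilbert_cube_diff_finite_dimensional[OF F dim])
    show "z \<in> hilbert_cube - F" "p \<in> hilbert_cube - F" by fact+
    show "joined b a" if "joined a b" for a b
      using that by (auto simp: joined_def)
    show "joined a c" if ab: "joined a b" and bc: "joined b c" for a b c
    proof -
      obtain S T where "compact S" "connected S" "S \<subseteq> hilbert_cube - F" "a \<in> S" "b \<in> S"
        "compact T" "connected T" "T \<subseteq> hilbert_cube - F" "b \<in> T" "c \<in> T"
        using ab bc unfolding joined_def by blast
      then show ?thesis
        unfolding joined_def by (intro exI[of _ "S \<union> T"]) (auto intro!: compact_Un connected_Un)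
    qed
    show "\<exists>T. openin (top_of_set (hilbert_cube - F)) T \<and> a \<in> T \<and> (\<forall>x\<in>T. joined a x)"
      if a: "a \<in> hilbert_cube - F" for a
    proof -
      obtain B W where BW: "compact B" "connected B" "B \<subseteq> hilbert_cube - F" "open W" "a \<in> W" "W \<inter> hilbert_cube \<subseteq> B"
        using local[OF a] by blast
      have "a \<in> B" using BW a by blast
      then have "\<forall>x\<in>(hilbert_cube - F) \<inter> W. joined a x"
        using BW unfolding joined_def by blast
      then show ?thesis using BW(4,5) a by (intro exI[of _ "(hilbert_cube - F) \<inter> W"]) (simp add: openin_open_Int)
    qed
  qed
  then obtain T where T: "compact T" "connected T" "T \<subseteq> hilbert_cube - F" "z \<in> T" "p \<in> T"
    unfolding joined_def by blast
  obtain B W where BW: "compact B" "connected B" "B \<subseteq> hilbert_cube - F" "open W" "z \<in> W" "W \<inter> hilbert_cube \<subseteq> B"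
    using local[OF z] by blast
  have "z \<in> T \<inter> B" using T BW z by blast
  then show thesis
    using T BW by (intro that[of "T \<union> B" W]) (auto intro!: compact_Un connected_Un)
qed

section \<open>Weak infinite-dimensionality\<close>

text \<open>By compactness, finitely many boxes that miss \<open>B\<close> and have their faces at
  coordinates in \<open>D\<close> cover \<open>A\<close>. The partition is the part of the closed
  boxes left over by the open ones, so each of its points lies on a face.\<close>

lemma partition_through_dense_coordinates:
  fixes K :: "(nat \<Rightarrow> real) set"
  assumes K: "compact K" and A: "closedin (top_of_set K) A" and B: "closedin (top_of_set K) B"
    and disj: "A \<inter> B = {}" and dense: "\<And>a b::real. a < b \<Longrightarrow> \<exists>t\<in>D. a < t \<and> t < b"
  obtains L where "partition_between (top_of_set K) L A B" "\<And>x. x \<in> L \<Longrightarrow> \<exists>i. x i \<in> D"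
proof -
  have cA: "compact A" using K A by (rule closedin_compact)
  have clB: "closed B" using K B by (meson closedin_compact compact_imp_closed)
  have AK: "A \<subseteq> K" "B \<subseteq> K" using A B closedin_imp_subset by auto
  have "\<exists>G C. open G \<and> closed C \<and> a \<in> G \<and> G \<subseteq> C \<and> C \<inter> B = {} \<and> (\<forall>x\<in>C - G. \<exists>i. x i \<in> D)"
    if a: "a \<in> A" for a
  proof -
    have "a \<in> - B" "open (- B)" using a disj clB by auto
    then obtain N e where e: "e > 0" "\<And>x. (\<And>i. i < N \<Longrightarrow> \<bar>x i - a i\<bar> \<le> e) \<Longrightarrow> x \<in> - B"
      using open_contains_coordinate_box by metis
    have "\<exists>l. \<forall>i. l i \<in> D \<and> a i - e < l i \<and> l i < a i"
      using dense[of "a i - e" "a i" for i] e(1) by (intro choice allI) auto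
    then obtain l where l: "\<And>i. l i \<in> D \<and> a i - e < l i \<and> l i < a i" by blast
    have "\<exists>r. \<forall>i. r i \<in> D \<and> a i < r i \<and> r i < a i + e"
      using dense[of "a i" "a i + e" for i] e(1) by (intro choice allI) auto
    then obtain r where r: "\<And>i. r i \<in> D \<and> a i < r i \<and> r i < a i + e" by blast
    define G where "G = {x. \<forall>i\<in>{..<N}. x i \<in> {l i<..<r i}}"
    define C where "C = (\<Inter>i\<in>{..<N}. {x. l i \<le> x i} \<inter> {x. x i \<le> r i})"
    have "open G"
      unfolding G_def by (rule product_topology_basis'[where x = "\<lambda>i. i"]) auto
    moreover have "closed C"
      unfolding C_def by (intro closed_INT ballI closed_Int closed_Collect_le continuous_on_const continuous_on_product_coordinates)
    moreover have "a \<in> G" using l r by (simp add: G_def)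
    moreover have "G \<subseteq> C" by (force simp: G_def C_def)
    moreover have "x \<in> - B" if x: "x \<in> C" for x
    proof (rule e(2))
      fix i assume "i < N"
      then have "l i \<le> x i" "x i \<le> r i" using x by (auto simp: C_def)
      then show "\<bar>x i - a i\<bar> \<le> e" using l[of i] r[of i] by linarith
    qed
    moreover have "\<exists>i. x i \<in> D" if x: "x \<in> C - G" for x
    proof -
      obtain i where "i < N" "x i \<notin> {l i<..<r i}" using x by (auto simp: G_def)
      moreover have "l i \<le> x i" "x i \<le> r i" using x \<open>i < N\<close> by (auto simp: C_def)
      ultimately have "x i = l i \<or> x i = r i" by auto
      then have "x i \<in> D" using l[of i] r[of i] by auto
      then show ?thesis ..
    qed
    ultimately have "open G \<and> closed C \<and> a \<in> G \<and> G \<subseteq> C \<and> C \<inter> B = {} \<and> (\<forall>x\<in>C - G. \<exists>i. x i \<in> D)"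
      by auto
    then show ?thesis by (intro exI)
  qed
  then have "\<forall>a\<in>A. \<exists>G C. open G \<and> closed C \<and> a \<in> G \<and> G \<subseteq> C \<and> C \<inter> B = {} \<and> (\<forall>x\<in>C - G. \<exists>i. x i \<in> D)"
    by (rule ballI)
  from bchoice[OF this] obtain box where "\<forall>a\<in>A. \<exists>C. open (box a) \<and> closed C \<and> a \<in> box a \<and> box a \<subseteq> C \<and>
      C \<inter> B = {} \<and> (\<forall>x\<in>C - box a. \<exists>i. x i \<in> D)" ..
  from bchoice[OF this] obtain cbox where "\<forall>a\<in>A. open (box a) \<and> closed (cbox a) \<and> a \<in> box a \<and>
      box a \<subseteq> cbox a \<and> cbox a \<inter> B = {} \<and> (\<forall>x\<in>cbox a - box a. \<exists>i. x i \<in> D)" ..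
  then have box: "\<And>a. a \<in> A \<Longrightarrow> open (box a)" "\<And>a. a \<in> A \<Longrightarrow> closed (cbox a)"
    "\<And>a. a \<in> A \<Longrightarrow> a \<in> box a" "\<And>a. a \<in> A \<Longrightarrow> box a \<subseteq> cbox a" "\<And>a. a \<in> A \<Longrightarrow> cbox a \<inter> B = {}"
    "\<And>a x. a \<in> A \<Longrightarrow> x \<in> cbox a - box a \<Longrightarrow> \<exists>i. x i \<in> D"
    by simp_all
  have "A \<subseteq> (\<Union>a\<in>A. box a)" using box(3) by blast
  then obtain C where C: "C \<subseteq> A" "finite C" "A \<subseteq> (\<Union>a\<in>C. box a)"
    using compactE_image[OF cA, of A box] box(1) by blast
  define U where "U = K \<inter> (\<Union>a\<in>C. box a)"
  define V where "V = K \<inter> - (\<Union>a\<in>C. cbox a)"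
  have opU: "openin (top_of_set K) U" unfolding U_def using C(1) by (intro openin_open_Int open_UN ballI box(1)) auto
  have "closed (\<Union>a\<in>C. cbox a)" using C(1,2) by (intro closed_UN ballI box(2)) auto
  then have opV: "openin (top_of_set K) V" unfolding V_def by (intro openin_open_Int open_Compl)
  show thesis
  proof (rule that[of "K - (U \<union> V)"])
    show "partition_between (top_of_set K) (K - (U \<union> V)) A B"
      unfolding partition_between_def
    proof (intro conjI, goal_cases)
      case 1
      show ?case
        using closedin_diff[OF closedin_topspace, of "top_of_set K" "U \<union> V"] openin_Un[OF opU opV] by simp
    next
      case 2
      have "A \<subseteq> U" using C(3) AK by (auto simp: U_def)
      moreover have "B \<inter> cbox a = {}" if "a \<in> C" for a using box(5)[of a] that C(1) by blast
      then have "B \<subseteq> V" using AK unfolding V_def by blast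
      moreover have "U \<inter> V = {}" using box(4) C(1) unfolding U_def V_def by blast
      moreover have "topspace (top_of_set K) - (K - (U \<union> V)) = U \<union> V" by (auto simp: U_def V_def)
      ultimately have "openin (top_of_set K) U \<and> openin (top_of_set K) V \<and> A \<subseteq> U \<and> B \<subseteq> V \<and> U \<inter> V = {} \<and>
          topspace (top_of_set K) - (K - (U \<union> V)) = U \<union> V"
        using opU opV by simp
      then show ?case by (intro exI)
    qed
  next
    fix x assume "x \<in> K - (U \<union> V)"
    then have x: "x \<in> (\<Union>a\<in>C. cbox a)" "x \<notin> (\<Union>a\<in>C. box a)" unfolding U_def V_def by blast+
    then obtain a where a: "a \<in> C" "x \<in> cbox a" "x \<notin> box a" by blast
    then show "\<exists>i. x i \<in> D" using box(6)[of a x] C(1) by blast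
  qed
qed

lemma weakly_infinite_dimensional_finite_support:
  fixes K :: "(nat \<Rightarrow> real) set"
  assumes K: "compact K" and supp: "\<And>x. x \<in> K \<Longrightarrow> finite {i. x i \<noteq> 0}"
  shows "weakly_infinite_dimensional (top_of_set K)"
  unfolding weakly_infinite_dimensional_def
proof (intro allI impI)
  fix A B :: "nat \<Rightarrow> (nat \<Rightarrow> real) set"
  assume AB: "\<forall>i. closedin (top_of_set K) (A i) \<and> closedin (top_of_set K) (B i) \<and> A i \<inter> B i = {}"
  \<comment> \<open>Multiples of an irrational \<open>t\<close> translate the rationals to distinct,
    dense cosets. The multiplier starts at 1, since the rationals themselves contain 0.\<close>
  have "(\<rat> :: real set) \<noteq> UNIV" using countable_rat uncountable_UNIV_real by metis
  then obtain t :: real where t: "t \<notin> \<rat>" by blast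
  \<comment> \<open>The dense sets \<open>D n\<close> are pairwise disjoint, so a point of all \<open>L n\<close> needs a different
    coordinate for each of them, and none of these coordinates is \<open>0\<close>.\<close>
  define D where "D n = (\<lambda>q. q + real (Suc n) * t) ` \<rat>" for n
  have D_disj: "m = n" if s: "s \<in> D m" "s \<in> D n" for m n s
  proof (rule ccontr)
    assume "m \<noteq> n"
    obtain p where p: "s = p + real (Suc m) * t" "p \<in> \<rat>" using s(1) unfolding D_def by (rule imageE)
    obtain q where q: "s = q + real (Suc n) * t" "q \<in> \<rat>" using s(2) unfolding D_def by (rule imageE)
    have "t * (real (Suc m) - real (Suc n)) = q - p"
      using p(1) q(1) by (simp add: algebra_simps)
    moreover have "real (Suc m) - real (Suc n) \<noteq> 0" using \<open>m \<noteq> n\<close> by simp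
    ultimately have "t = (q - p) / (real (Suc m) - real (Suc n))"
      by (metis nonzero_mult_div_cancel_right)
    also have "\<dots> \<in> \<rat>" using p q by (intro Rats_divide Rats_diff Rats_of_nat)
    finally show False using t by simp
  qed
  have D_0: "0 \<notin> D n" for n
  proof
    assume "0 \<in> D n"
    then obtain q where q: "0 = q + real (Suc n) * t" "q \<in> \<rat>" unfolding D_def by (rule imageE)
    have "t * real (Suc n) = - q" using q(1) by (simp add: algebra_simps)
    then have "t = - q / real (Suc n)"
      by (metis nonzero_mult_div_cancel_right of_nat_eq_0_iff nat.distinct(2))
    also have "\<dots> \<in> \<rat>" using q(2) by (intro Rats_divide Rats_of_nat) simp
    finally show False using t by simp
  qed
  have D_dense: "\<exists>s\<in>D n. a < s \<and> s < b" if "a < b" for n a b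
  proof -
    have "a - real (Suc n) * t < b - real (Suc n) * t" using that by simp
    then obtain q where "q \<in> \<rat>" "a - real (Suc n) * t < q" "q < b - real (Suc n) * t"
      using Rats_dense_in_real by blast
    then show ?thesis by (intro bexI[of _ "q + real (Suc n) * t"]) (auto simp: D_def)
  qed
  have "\<exists>L. partition_between (top_of_set K) L (A n) (B n) \<and> (\<forall>x\<in>L. \<exists>i. x i \<in> D n)" for n
    using partition_through_dense_coordinates[OF K, of "A n" "B n" "D n"] AB D_dense by metis
  then obtain L where L: "\<And>n. partition_between (top_of_set K) (L n) (A n) (B n)"
    "\<And>n x. x \<in> L n \<Longrightarrow> \<exists>i. x i \<in> D n"
    by metis
  have "x \<notin> (\<Inter>n. L n)" for x
  proof
    assume x: "x \<in> (\<Inter>n. L n)"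
    then obtain f where f: "\<And>n. x (f n) \<in> D n" using L(2) by (metis INT_E UNIV_I)
    have "x \<in> K" using x L(1)[of 0] closedin_imp_subset by (fastforce simp: partition_between_def)
    then have fin: "finite {i. x i \<noteq> 0}" by (rule supp)
    have "inj f" using f D_disj by (metis injI)
    moreover have "range f \<subseteq> {i. x i \<noteq> 0}" using f D_0 by (metis (mono_tags) image_subsetI mem_Collect_eq)
    ultimately show False using fin by (meson finite_subset range_inj_infinite)
  qed
  then show "\<exists>L. (\<forall>i. partition_between (top_of_set K) (L i) (A i) (B i)) \<and> (\<Inter>i. L i) = {}"
    using L(1) by (intro exI[of _ L]) blast
qed

section \<open>Hilbert cubes glued along a weakly infinite-dimensional set\<close>

text \<open>The copy of the Hilbert cube at height \<open>c\<close>: the factor \<open>infdist\<close> glues all copies together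
  exactly along \<open>shrinking_cubes\<close>.\<close>

definition slice :: "real \<Rightarrow> (nat \<Rightarrow> real) \<Rightarrow> nat \<Rightarrow> real" where
  "slice c z = case_nat (c * infdist z shrinking_cubes) z"

definition tail :: "(nat \<Rightarrow> real) \<Rightarrow> nat \<Rightarrow> real" where
  "tail y = (\<lambda>i. y (Suc i))"

definition heights :: "real set" where
  "heights = insert 0 (range (\<lambda>n. inverse (real (Suc n))))"

text \<open>The quotient is realised inside the space of sequences: metrizability is inherited, and
  compactness comes from a continuous image.\<close>

definition pinched_product :: "(nat \<Rightarrow> real) set" where
  "pinched_product = (\<lambda>(c, z). slice c z) ` (heights \<times> hilbert_cube)"

lemma slice_0 [simp]: "slice c z 0 = c * infdist z shrinking_cubes"
  by (simp add: slice_def)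

lemma slice_Suc [simp]: "slice c z (Suc i) = z i"
  by (simp add: slice_def)

lemma tail_slice [simp]: "tail (slice c z) = z"
  by (simp add: tail_def)

lemma slice_shrinking_cubes: "z \<in> shrinking_cubes \<Longrightarrow> slice c z = slice 0 z"
  by (simp add: slice_def)

lemma infdist_shrinking_cubes_pos:
  "z \<notin> shrinking_cubes \<Longrightarrow> infdist z shrinking_cubes > 0"
  using infdist_pos_not_in_closed[OF closed_shrinking_cubes] zero_in_shrinking_cubes by blast

lemma continuous_on_slice_prod: "continuous_on S (\<lambda>(c, z). slice c z)"
proof (rule continuous_on_coordinatewise_then_product)
  fix i
  show "continuous_on S (\<lambda>x. (case x of (c, z) \<Rightarrow> slice c z) i)"
  proof (cases i)
    case 0
    show ?thesis
      by (simp add: 0 split_beta continuous_on_mult continuous_on_infdist continuous_on_fst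
          continuous_on_snd continuous_on_id)
  next
    case (Suc j)
    have "continuous_on S (\<lambda>x. snd x j)"
      by (rule continuous_on_product_then_coordinatewise) (simp add: continuous_on_snd continuous_on_id)
    then show ?thesis by (simp add: Suc split_beta)
  qed
qed

lemma continuous_on_slice: "continuous_on S (slice c)"
proof -
  have "continuous_on S ((\<lambda>(c, z). slice c z) \<circ> (\<lambda>z. (c, z)))"
    by (intro continuous_on_compose continuous_on_slice_prod continuous_on_Pair continuous_on_const continuous_on_id)
  then show ?thesis by (simp add: comp_def)
qed

lemma inj_slice: "inj (slice c)"
  by (metis injI tail_slice)

lemma continuous_on_tail: "continuous_on S tail"
  by (intro continuous_on_coordinatewise_then_product)
    (simp add: tail_def continuous_on_subset[OF continuous_on_product_coordinates])

lemma compact_heights: "compact heights"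
  unfolding heights_def by (rule compact_sequence_with_limit[OF LIMSEQ_inverse_real_of_nat])

lemma countable_heights: "countable heights"
  by (simp add: heights_def)

text \<open>The set \<open>C\<close> is usually disconnected; the copies of \<open>T\<close> hang
  together because all of them contain the point \<open>slice 0 p\<close>.\<close>

lemma slice_Times_continuum:
  assumes C: "C \<subseteq> heights" "compact C" "C \<noteq> {}"
    and T: "compact T" "connected T" "T \<subseteq> hilbert_cube" "p \<in> T" "p \<in> shrinking_cubes"
  defines "M \<equiv> (\<lambda>(c, z). slice c z) ` (C \<times> T)"
  shows "compact M" "connected M" "M \<subseteq> pinched_product" "M \<noteq> {}"
proof -
  show "compact M"
    unfolding M_def using C T by (intro compact_continuous_image continuous_on_slice_prod compact_Times)
  have "M = \<Union>((\<lambda>c. slice c ` T) ` C)" by (auto simp: M_def)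
  moreover have "connected (\<Union>((\<lambda>c. slice c ` T) ` C))"
  proof (rule connected_Union)
    show "connected s" if "s \<in> (\<lambda>c. slice c ` T) ` C" for s
      using that T(2) connected_continuous_image[OF continuous_on_slice] by auto
    have "slice 0 p \<in> slice c ` T" for c
      using slice_shrinking_cubes[OF T(5), of c] T(4) by (metis imageI)
    then show "\<Inter>((\<lambda>c. slice c ` T) ` C) \<noteq> {}" by blast
  qed
  ultimately show "connected M" by simp
  show "M \<subseteq> pinched_product" using C T by (auto simp: M_def pinched_product_def)
  show "M \<noteq> {}" using C T by (auto simp: M_def)
qed

section \<open>The pinched product as a continuum\<close>

lemma continuum_top_of_set:
  fixes S :: "'a::metric_space set"
  shows "continuum (top_of_set S) \<longleftrightarrow> compact S \<and> connected S \<and> S \<noteq> {}"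
proof -
  have "connected_space (top_of_set S) \<longleftrightarrow> connected S"
    using connectedin_iff_connected[of S] by (simp add: connectedin_def del: connectedin_iff_connected)
  moreover have "compact_space (top_of_set S) \<longleftrightarrow> compact S"
    by (simp add: compact_space_def compactin_subtopology)
  ultimately show ?thesis
    by (simp add: continuum_def compactum_def metrizable_space_subtopology metrizable_space_euclidean)
qed

lemma subcontinuum_of_top_of_set:
  fixes S T :: "'a::metric_space set"
  shows "subcontinuum_of T (top_of_set S) \<longleftrightarrow> T \<subseteq> S \<and> compact T \<and> connected T \<and> T \<noteq> {}"
proof (cases "T \<subseteq> S")
  case True
  then have "subtopology (top_of_set S) T = top_of_set T"
    by (simp add: subtopology_subtopology Int_absorb1)
  then show ?thesis using True by (simp add: subcontinuum_of_def continuum_top_of_set)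
qed (simp add: subcontinuum_of_def)

lemma interior_of_top_of_setI:
  assumes "open W" "x \<in> W" "x \<in> S" "S \<inter> W \<subseteq> T"
  shows "x \<in> top_of_set S interior_of T"
  using assms openin_open_Int[of W S] unfolding interior_of_def by blast

lemma continuum_pinched_product: "continuum (top_of_set pinched_product)"
proof -
  have "connected hilbert_cube" by (simp add: hilbert_cube_def connected_fun_interval)
  moreover have "(\<lambda>_. 0) \<in> hilbert_cube" using zero_in_shrinking_cubes shrinking_cubes_subset by blast
  moreover have "heights \<noteq> {}" by (simp add: heights_def)
  ultimately show ?thesis
    unfolding continuum_top_of_set pinched_product_def
    using slice_Times_continuum[OF subset_refl compact_heights _ compact_hilbert_cube _ subset_refl _ zero_in_shrinking_cubes]
    by blast
qed

section \<open>Avoiding finite-dimensional closed sets\<close>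

lemma finite_dimensional_closed_set_aposyndetic_pinched_product:
  "finite_dimensional_closed_set_aposyndetic (top_of_set pinched_product)"
  unfolding finite_dimensional_closed_set_aposyndetic_def
proof (intro allI impI, elim conjE)
  fix x F
  assume x: "x \<in> topspace (top_of_set pinched_product)" and clF: "closedin (top_of_set pinched_product) F"
    and "finite_dimensional (subtopology (top_of_set pinched_product) F)"
    and FX: "F \<subseteq> topspace (top_of_set pinched_product) - {x}"
  then obtain d where "covering_dim_le (subtopology (top_of_set pinched_product) F) d"
    by (auto simp: finite_dimensional_def)
  moreover have "subtopology (top_of_set pinched_product) F = top_of_set F"
    using FX by (simp add: subtopology_subtopology Int_absorb1 subset_Diff_insert)
  ultimately have dim: "covering_dim_le (top_of_set F) d" by simp
  have F: "closed F"
    using closedin_compact[OF _ clF] continuum_pinched_product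
    by (auto simp: continuum_top_of_set compact_imp_closed)
  obtain c z where cz: "c \<in> heights" "z \<in> hilbert_cube" "x = slice c z"
    using x by (auto simp: pinched_product_def)
  have xF: "slice c z \<notin> F" using FX cz by auto
  have cont: "continuous_on UNIV (\<lambda>(c, z). slice c z)" by (rule continuous_on_slice_prod)
  have goal: "\<exists>T. subcontinuum_of T (top_of_set pinched_product) \<and> x \<in> top_of_set pinched_product interior_of T \<and>
      T \<subseteq> topspace (top_of_set pinched_product) - F"
    if C: "C \<subseteq> heights" "compact C" "c \<in> C"
      and T: "compact T" "connected T" "T \<subseteq> hilbert_cube" "p \<in> T" "p \<in> shrinking_cubes"
      and off: "\<And>c z. c \<in> C \<Longrightarrow> z \<in> T \<Longrightarrow> slice c z \<notin> F"
      and W: "open W" "x \<in> W" "pinched_product \<inter> W \<subseteq> (\<lambda>(c, z). slice c z) ` (C \<times> T)" for C T W p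
  proof (intro exI conjI)
    let ?M = "(\<lambda>(c, z). slice c z) ` (C \<times> T)"
    have M: "compact ?M" "connected ?M" "?M \<subseteq> pinched_product" "?M \<noteq> {}"
      using slice_Times_continuum[OF C(1,2) _ T] C(3) by auto
    then show "subcontinuum_of ?M (top_of_set pinched_product)"
      by (simp add: subcontinuum_of_top_of_set)
    show "x \<in> top_of_set pinched_product interior_of ?M"
      using x by (intro interior_of_top_of_setI[OF W(1,2) _ W(3)]) simp
    show "?M \<subseteq> topspace (top_of_set pinched_product) - F"
      using M(3) off by auto
  qed
  have tail_open: "open (tail -` W)" if "open W" for W
    using that continuous_on_tail[of UNIV] by (simp add: open_vimage)
  show "\<exists>T. subcontinuum_of T (top_of_set pinched_product) \<and> x \<in> top_of_set pinched_product interior_of T \<and>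
      T \<subseteq> topspace (top_of_set pinched_product) - F"
  proof (cases "z \<in> shrinking_cubes")
    case True
    \<comment> \<open>Here \<open>x\<close> belongs to every copy, so a neighbourhood has to reach
      into all of them: \<open>C\<close> is all of \<open>heights\<close>, and the tube lemma over
      this compact set gives one box that avoids \<open>F\<close> at each height.\<close>
    have opn: "open ((\<lambda>q. slice (snd q) (fst q)) -` (- F))"
    proof (rule open_vimage)
      have "continuous_on UNIV ((\<lambda>(c, z). slice c z) \<circ> (\<lambda>q. (snd q, fst q)))"
        by (intro continuous_on_compose continuous_on_slice_prod continuous_on_Pair continuous_on_fst
            continuous_on_snd continuous_on_id)
      then show "continuous_on UNIV (\<lambda>q. slice (snd q) (fst q))" by (simp add: comp_def)
    qed (use F in auto)
    have sub: "{z} \<times> heights \<subseteq> (\<lambda>q. slice (snd q) (fst q)) -` (- F)"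
    proof -
      have "slice c' z \<notin> F" for c' using xF slice_shrinking_cubes[OF True] by metis
      then show ?thesis by auto
    qed
    obtain G where G: "z \<in> G" "open G" "G \<times> heights \<subseteq> (\<lambda>q. slice (snd q) (fst q)) -` (- F)"
      using Elementary_Topology.tube_lemma[OF compact_heights opn sub] by (elim exE conjE)
    obtain B W where BW: "compact B" "connected B" "B \<subseteq> hilbert_cube \<inter> G" "open W" "z \<in> W"
      "W \<inter> hilbert_cube \<subseteq> B"
      by (rule hilbert_cube_local_continuum[OF G(2,1) cz(2)])
    show ?thesis
    proof (rule goal[of heights B z "tail -` W"])
      show "z \<in> B" using BW cz by blast
      show "slice c w \<notin> F" if "c \<in> heights" "w \<in> B" for c w
      proof -
        have "(w, c) \<in> G \<times> heights" using that BW(3) by blast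
        from subsetD[OF G(3) this] show ?thesis by simp
      qed
      show "pinched_product \<inter> tail -` W \<subseteq> (\<lambda>(c, z). slice c z) ` (heights \<times> B)"
      proof
        fix y assume y: "y \<in> pinched_product \<inter> tail -` W"
        then obtain c' w where cw: "c' \<in> heights" "w \<in> hilbert_cube" "y = slice c' w"
          by (auto simp: pinched_product_def)
        then have "(c', w) \<in> heights \<times> B" using y BW(6) by auto
        then show "y \<in> (\<lambda>(c, z). slice c z) ` (heights \<times> B)" by (rule rev_image_eqI) (simp add: cw(3))
      qed
    qed (use BW cz compact_heights True tail_open in auto)
  next
    case False
    define F' where "F' = hilbert_cube \<inter> slice c -` F"
    have F': "closed F'"
      unfolding F'_def using F by (intro closed_Int closed_hilbert_cube closed_vimage continuous_on_slice)
    have "compact F'"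
      unfolding F'_def using F by (intro compact_Int_closed compact_hilbert_cube closed_vimage continuous_on_slice)
    then have dim': "covering_dim_le (top_of_set F') d"
      by (rule covering_dim_le_pullback[where g = "slice c", OF _ continuous_on_slice inj_on_subset[OF inj_slice] _ dim])
        (auto simp: F'_def)
    obtain p where p: "p \<in> shrinking_cubes" "p \<notin> F'"
      using shrinking_cubes_not_subset_finite_dimensional[OF F' dim'] by blast
    have pz: "z \<in> hilbert_cube - F'" "p \<in> hilbert_cube - F'"
      using p shrinking_cubes_subset cz xF by (auto simp: F'_def)
    obtain T W where TW: "compact T" "connected T" "T \<subseteq> hilbert_cube - F'" "p \<in> T"
      "open W" "z \<in> W" "W \<inter> hilbert_cube \<subseteq> T"
      by (rule hilbert_cube_diff_continuum[OF F' dim' pz])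
    have opn: "open ((\<lambda>(c, z). slice c z) -` (- F))"
      using F by (intro open_vimage continuous_on_slice_prod) auto
    have sub: "{c} \<times> T \<subseteq> (\<lambda>(c, z). slice c z) -` (- F)"
      using TW(3) by (auto simp: F'_def)
    \<comment> \<open>The tube lemma along the compact \<open>T\<close> carries avoidance of
      \<open>F\<close> from the height \<open>c\<close> to all nearby heights.\<close>
    obtain G where G: "c \<in> G" "open G" "G \<times> T \<subseteq> (\<lambda>(c, z). slice c z) -` (- F)"
      using Elementary_Topology.tube_lemma[OF TW(1) opn sub] by (elim exE conjE)
    obtain e where e: "e > 0" "cball c e \<subseteq> G"
      using G(1,2) open_contains_cball by blast
    let ?\<rho> = "\<lambda>y. infdist (tail y) shrinking_cubes"
    \<comment> \<open>Off the gluing set the height of \<open>y\<close> is \<open>y 0\<close>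
      divided by \<open>?\<rho> y\<close>; the last condition says that it is within
      \<open>e\<close> of \<open>c\<close>, with the denominator cleared.\<close>
    define W' where "W' = tail -` W \<inter> {y. 0 < ?\<rho> y} \<inter> {y. \<bar>y 0 - c * ?\<rho> y\<bar> < e * ?\<rho> y}"
    show ?thesis
    proof (rule goal[of "heights \<inter> cball c e" T p W'])
      show "compact (heights \<inter> cball c e)" by (intro compact_Int compact_heights compact_cball)
      show "c \<in> heights \<inter> cball c e" using cz(1) e(1) by simp
      show "slice c' w \<notin> F" if "c' \<in> heights \<inter> cball c e" "w \<in> T" for c' w
      proof -
        have "(c', w) \<in> G \<times> T" using that e(2) by blast
        from subsetD[OF G(3) this] show ?thesis by simp
      qed
      have "continuous_on UNIV ?\<rho>" by (intro continuous_on_infdist continuous_on_tail)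
      then show "open W'"
        unfolding W'_def using TW(5)
        by (intro open_Int tail_open open_Collect_less continuous_on_const continuous_on_mult
            continuous_on_rabs continuous_on_diff continuous_on_product_coordinates)
      show "x \<in> W'"
        using TW(6) infdist_shrinking_cubes_pos[OF False] e(1) by (simp add: W'_def cz(3))
      show "pinched_product \<inter> W' \<subseteq> (\<lambda>(c, z). slice c z) ` ((heights \<inter> cball c e) \<times> T)"
      proof
        fix y assume y: "y \<in> pinched_product \<inter> W'"
        then obtain c' w where cw: "c' \<in> heights" "w \<in> hilbert_cube" "y = slice c' w"
          by (auto simp: pinched_product_def)
        define r where "r = infdist w shrinking_cubes"
        have w: "w \<in> W" "r > 0" "\<bar>c' * r - c * r\<bar> < e * r"
          using y by (auto simp: W'_def cw(3) r_def)
        have "\<bar>c' - c\<bar> * r < e * r"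
          using w(2,3) by (metis abs_mult abs_of_pos left_diff_distrib)
        then have "\<bar>c' - c\<bar> < e" using w(2) by simp
        then have "c' \<in> cball c e" by (simp add: dist_real_def abs_minus_commute)
        then show "y \<in> (\<lambda>(c, z). slice c z) ` ((heights \<inter> cball c e) \<times> T)"
          using cw w(1) TW(7) by (intro rev_image_eqI[of "(c', w)"]) auto
      qed
    qed (use TW p in auto)
  qed
qed

section \<open>Failure for the weakly infinite-dimensional gluing set\<close>

lemma not_weakly_infinite_dimensional_closed_set_aposyndetic_pinched_product:
  "\<not> weakly_infinite_dimensional_closed_set_aposyndetic (top_of_set pinched_product)"
proof
  assume apo: "weakly_infinite_dimensional_closed_set_aposyndetic (top_of_set pinched_product)"
  \<comment> \<open>The all-ones point is off the gluing set: the defining inequality fails at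
    \<open>i = j = 1\<close>.\<close>
  define z :: "nat \<Rightarrow> real" where "z = (\<lambda>_. 1)"
  have z: "z \<in> hilbert_cube" "z \<notin> shrinking_cubes"
    by (auto simp: z_def hilbert_cube_iff shrinking_cubes_def intro!: exI[of _ 1])
  define A where "A = slice 0 ` shrinking_cubes"
  have "compact shrinking_cubes"
    using compact_Int_closed[OF compact_hilbert_cube closed_shrinking_cubes] shrinking_cubes_subset
    by (simp add: Int_absorb1)
  then have cA: "compact A" unfolding A_def by (intro compact_continuous_image continuous_on_slice)
  have A_sub: "A \<subseteq> pinched_product"
    using shrinking_cubes_subset by (auto simp: A_def pinched_product_def heights_def)
  have "finite {i. x i \<noteq> 0}" if x: "x \<in> A" for x
  proof -
    obtain w where w: "w \<in> shrinking_cubes" "x = slice 0 w" using x by (auto simp: A_def)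
    have "{i. x i \<noteq> 0} \<subseteq> Suc ` {i. w i \<noteq> 0}"
    proof
      fix i assume "i \<in> {i. x i \<noteq> 0}"
      then show "i \<in> Suc ` {i. w i \<noteq> 0}" by (cases i) (auto simp: w(2))
    qed
    then show ?thesis using finite_support_shrinking_cubes[OF w(1)] finite_surj by blast
  qed
  then have "weakly_infinite_dimensional (top_of_set A)"
    by (rule weakly_infinite_dimensional_finite_support[OF cA])
  moreover have "subtopology (top_of_set pinched_product) A = top_of_set A"
    using A_sub by (simp add: subtopology_subtopology Int_absorb1)
  moreover have "closedin (top_of_set pinched_product) A"
    using A_sub cA by (simp add: closed_subset compact_imp_closed)
  moreover have z0: "slice 0 z \<in> pinched_product" "slice 0 z \<notin> A"
    using z inj_slice by (auto simp: A_def pinched_product_def heights_def inj_image_mem_iff)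
  ultimately have "\<exists>T. subcontinuum_of T (top_of_set pinched_product) \<and>
      slice 0 z \<in> top_of_set pinched_product interior_of T \<and> T \<subseteq> pinched_product - A"
    using apo[unfolded weakly_infinite_dimensional_closed_set_aposyndetic_def, rule_format, of "slice 0 z" A] A_sub
    by auto
  then obtain T where T: "subcontinuum_of T (top_of_set pinched_product)"
    "slice 0 z \<in> top_of_set pinched_product interior_of T" "T \<subseteq> pinched_product - A"
    by blast
  obtain W where W: "open W" "slice 0 z \<in> W" "pinched_product \<inter> W \<subseteq> T"
    using T(2) by (auto simp: interior_of_def openin_open)
  \<comment> \<open>The height, recovered continuously wherever the denominator is nonzero; this
    holds on \<open>T\<close> because \<open>T\<close> misses \<open>A\<close>.\<close>
  define r where "r y = y 0 / infdist (tail y) shrinking_cubes" for y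
  have r_slice: "r (slice c w) = c" if "w \<notin> shrinking_cubes" for c w
    using infdist_shrinking_cubes_pos[OF that] by (simp add: r_def)
  have T_slice: "\<exists>c w. c \<in> heights \<and> y = slice c w \<and> w \<notin> shrinking_cubes" if y: "y \<in> T" for y
  proof -
    obtain c w where cw: "c \<in> heights" "y = slice c w" using y T(3) by (auto simp: pinched_product_def)
    then have "w \<notin> shrinking_cubes"
      using y T(3) slice_shrinking_cubes[of w c] by (auto simp: A_def)
    then show ?thesis using cw by blast
  qed
  have "continuous_on T r"
    unfolding r_def
  proof (intro continuous_on_divide continuous_on_infdist continuous_on_tail ballI)
    show "continuous_on T (\<lambda>y. y 0)" by (rule continuous_on_subset[OF continuous_on_product_coordinates]) simp
    show "infdist (tail y) shrinking_cubes \<noteq> 0" if "y \<in> T" for y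
      using T_slice[OF that] infdist_shrinking_cubes_pos by force
  qed
  moreover have "connected T" using T(1) by (simp add: subcontinuum_of_top_of_set)
  ultimately have conn: "connected (r ` T)" by (rule connected_continuous_image)
  have "r ` T \<subseteq> heights" using T_slice r_slice by fastforce
  then have cnt: "countable (r ` T)" using countable_heights countable_subset by blast
  have "slice 0 z \<in> T" using W z0(1) by blast
  then have r0: "0 \<in> r ` T" using r_slice[OF z(2), of 0] by force
  have "(\<lambda>n. slice (inverse (real (Suc n))) z) \<longlonglongrightarrow> slice 0 z"
  proof (rule LIMSEQ_coordinatewise)
    fix i
    have "(\<lambda>n. inverse (real (Suc n)) * infdist z shrinking_cubes) \<longlonglongrightarrow> 0 * infdist z shrinking_cubes"
      by (intro tendsto_mult LIMSEQ_inverse_real_of_nat tendsto_const)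
    then show "(\<lambda>n. slice (inverse (real (Suc n))) z i) \<longlonglongrightarrow> slice 0 z i" by (cases i) simp_all
  qed
  then have "\<forall>\<^sub>F n in sequentially. slice (inverse (real (Suc n))) z \<in> W"
    using W(1,2) by (rule topological_tendstoD)
  then obtain n where n: "slice (inverse (real (Suc n))) z \<in> W"
    by (meson eventually_sequentially order_refl)
  have "slice (inverse (real (Suc n))) z \<in> pinched_product"
    using z(1) by (auto simp: pinched_product_def heights_def)
  then have "slice (inverse (real (Suc n))) z \<in> T" using n W(3) by blast
  then have "r (slice (inverse (real (Suc n))) z) \<in> r ` T" by (rule imageI)
  then have "inverse (real (Suc n)) \<in> r ` T" by (simp only: r_slice[OF z(2)])
  \<comment> \<open>A connected set of reals with the two points 0 and 1/(n+1) is uncountable, yet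
    \<open>T\<close> has only countably many heights.\<close>
  then have "uncountable (r ` T)"
    using connected_uncountable[OF conn r0] by simp
  then show False using cnt by simp
qed

(* The topology and its underlying set are arbitrary; only the type of points is fixed.
   Every compactum embeds in the Hilbert cube, hence has a homeomorphic copy whose points
   are of type nat => real. *)
theorem mainTheorem3:
  shows "\<exists>X :: (nat \<Rightarrow> real) topology.
           continuum X \<and>
           finite_dimensional_closed_set_aposyndetic X \<and>
           \<not> weakly_infinite_dimensional_closed_set_aposyndetic X"
  using continuum_pinched_product finite_dimensional_closed_set_aposyndetic_pinched_product
    not_weakly_infinite_dimensional_closed_set_aposyndetic_pinched_product
  by blast

end
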